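(* Let $k\ge 2$ be an integer, let $\{f(n)\}_{n\ge 0}$ be a $k$-regular sequence of integers, let $F(x)=\sum_{n\ge 0} f(n)x^n\in\mathbb{Z}[[x]]$, and let $b\ge 2$ be an integer. If $\xi=F(1/b)$ is irrational, then $\xi$ is an $S$-number or a $T$-number in Mahler's classification.
   Context: The $k$-kernel of a sequence $\{f(n)\}_{n\ge0}$ is the set of distinct subsequences $\{f(k^\ell n+r)\}_{n\ge0}$ with $\ell\ge0$, $0\le r<k^\ell$; the sequence is $k$-regular if the $\mathbb{Q}$-span of its $k$-kernel is finite-dimensional. For a real transcendental or irrational number $\xi$ and an integer $m\ge1$, $w_m(\xi)$ is the supremum of real $w$ such that $0<|P(\xi)|<H(P)^{-w}$ has infinitely many solutions in integer polynomials $P$ of degree at most $m$, where $H(P)$ is the maximum absolute value of the coefficients of $P$; put $w(\xi)=\limsup_{m\to\infty} w_m(\xi)/m$. $\xi$ is an $S$-number if $w(\xi)<\infty$; a $T$-number if $w(\xi)=\infty$ and $w_m(\xi)<\infty$ for all $m\ge1$; a $U$-number if $w(\xi)=\infty$ and $w_m(\xi)=\infty$ for some $m\ge1$. *)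

theory Defs
  imports "HOL-Analysis.Analysis" "HOL-Library.Function_Algebras"
begin

definition kernel :: "nat \<Rightarrow> (nat \<Rightarrow> int) \<Rightarrow> (nat \<Rightarrow> int) set" where
  "kernel k f = {(\<lambda>n. f (k ^ l * n + r)) | l r. r < k ^ l}"

definition seq_scale :: "rat \<Rightarrow> (nat \<Rightarrow> rat) \<Rightarrow> nat \<Rightarrow> rat" where
  "seq_scale c g = (\<lambda>n. c * g n)"

global_interpretation rat_seq: vector_space seq_scale
  by unfold_locales (auto simp: seq_scale_def fun_eq_iff algebra_simps)

definition regular :: "nat \<Rightarrow> (nat \<Rightarrow> int) \<Rightarrow> bool" where
  "regular k f \<longleftrightarrow>
     (\<exists>B. finite B \<and> rat_seq.span ((\<lambda>g n. rat_of_int (g n)) ` kernel k f) = rat_seq.span B)"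

definition height :: "int poly \<Rightarrow> int" where
  "height P = Max ((\<lambda>i. \<bar>coeff P i\<bar>) ` {..degree P})"

definition mahler_w :: "nat \<Rightarrow> real \<Rightarrow> ereal" where
  "mahler_w m \<xi> = Sup {ereal w | w.
     infinite {P :: int poly. degree P \<le> m \<and>
       0 < \<bar>poly (map_poly real_of_int P) \<xi>\<bar> \<and>
       \<bar>poly (map_poly real_of_int P) \<xi>\<bar> < real_of_int (height P) powr (- w)}}"

definition mahler_w_lim :: "real \<Rightarrow> ereal" where
  "mahler_w_lim \<xi> = limsup (\<lambda>m. mahler_w m \<xi> / ereal (real m))"

text \<open>
  The classes are considered for irrational \<open>\<xi>\<close> only. Algebraic irrational numbers are
  not split off into a separate class here: they satisfy \<open>mahler_w_lim \<xi> < \<infinity>\<close>.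
\<close>

definition S_number :: "real \<Rightarrow> bool" where
  "S_number \<xi> \<longleftrightarrow> \<xi> \<notin> \<rat> \<and> mahler_w_lim \<xi> < \<infinity>"

definition T_number :: "real \<Rightarrow> bool" where
  "T_number \<xi> \<longleftrightarrow> \<xi> \<notin> \<rat> \<and> mahler_w_lim \<xi> = \<infinity> \<and> (\<forall>m\<ge>1. mahler_w m \<xi> < \<infinity>)"

end

theory Submission
  imports Defs
begin

text \<open>
  It suffices to bound every exponent \<open>w\<^sub>m(\<xi>)\<close>, and this needs neither the Subspace Theorem nor any
  zero estimate. A finite spanning set of the \<open>k\<close>-kernel gives a linear system
  \<open>G(x) = A(x) G(x\<^sup>k)\<close>; the degree-\<open>m\<close> monomials in the entries of \<open>G\<close> (the constant series \<open>1\<close>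
  included) satisfy a system of the same kind, so that \<open>P(\<xi>)\<close> becomes an integer linear form
  \<open>L = c \<cdot> H(1/b)\<close> in its values. Iterating the functional equation transports \<open>L\<close> to the point
  \<open>x\<^sub>n = b^(-k^n)\<close>, that is \<open>L = u\<^sub>n \<cdot> H(x\<^sub>n)\<close>. Replacing \<open>H\<close> by simultaneous Pade approximants
  \<open>p/q\<close> of a fixed high order yields \<open>q(x\<^sub>n) L = y\<^sub>n + (small)\<close>, where \<open>y\<^sub>n = u\<^sub>n \<cdot> p(x\<^sub>n)\<close> is rational
  with a controlled denominator; whenever \<open>y\<^sub>n \<noteq> 0\<close> this bounds \<open>|L|\<close> from below. The numbers \<open>y\<^sub>n\<close>
  satisfy a linear recurrence whose coefficients are values at \<open>x\<^sub>n\<close> of polynomials that do not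
  depend on \<open>c\<close>. Hence a bounded run of zeros, once \<open>n\<close> is large, forces all later \<open>y\<^sub>n\<close> to vanish
  and then \<open>L = 0\<close>. So a nonzero \<open>y\<^sub>n\<close> occurs within a bounded distance of any index, and \<open>|L|\<close> is at
  least a negative power of the height.
\<close>

section \<open>Linear algebra\<close>

text \<open>Subrings as carrier sets: one elimination lemma then serves both the rationals inside
  the reals and a full polynomial ring.\<close>

definition ring_closed :: "'a::comm_ring_1 set \<Rightarrow> bool" where
  "ring_closed S \<longleftrightarrow> 0 \<in> S \<and> 1 \<in> S \<and>
     (\<forall>x\<in>S. \<forall>y\<in>S. x + y \<in> S \<and> x * y \<in> S) \<and> (\<forall>x\<in>S. - x \<in> S)"

lemma ring_closed_sum:
  assumes "ring_closed S" "\<And>i. i \<in> I \<Longrightarrow> f i \<in> S"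
  shows "sum f I \<in> S"
  using assms(2)
proof (induction I rule: infinite_finite_induct)
  case (insert i I)
  then show ?case using assms(1) by (auto simp: ring_closed_def)
qed (use assms(1) in \<open>auto simp: ring_closed_def\<close>)

text \<open>Fraction-free Gaussian elimination, by induction on the number of equations. No division
  occurs, so the argument works over a domain and the solution stays in the subring
  \<open>S\<close>.\<close>

lemma homogeneous_system_solution:
  fixes a :: "'j \<Rightarrow> 'i \<Rightarrow> 'a::idom"
  assumes S: "ring_closed S"
    and "finite J" "finite I" "card J < card I"
    and "\<And>j i. j \<in> J \<Longrightarrow> i \<in> I \<Longrightarrow> a j i \<in> S"
  shows "\<exists>x. (\<forall>i\<in>I. x i \<in> S) \<and> (\<exists>i\<in>I. x i \<noteq> 0) \<and> (\<forall>j\<in>J. (\<Sum>i\<in>I. a j i * x i) = 0)"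
  using assms(2-)
proof (induction J arbitrary: I a rule: finite_induct)
  case empty
  then obtain i where "i \<in> I" by fastforce
  then show ?case
    by (intro exI[of _ "\<lambda>_. 1"]) (use S in \<open>auto simp: ring_closed_def\<close>)
next
  case (insert j J)
  show ?case
  proof (cases "\<forall>i\<in>I. a j i = 0")
    case True
    have "\<exists>x. (\<forall>i\<in>I. x i \<in> S) \<and> (\<exists>i\<in>I. x i \<noteq> 0) \<and> (\<forall>j\<in>J. (\<Sum>i\<in>I. a j i * x i) = 0)"
      by (rule insert.IH) (use insert.prems insert.hyps in auto)
    then show ?thesis using True by auto
  next
    case False
    then obtain l where l: "l \<in> I" "a j l \<noteq> 0" by blast
    define I' where "I' = I - {l}"
    \<comment> \<open>Cross-multiplication with the pivot row \<open>j\<close> eliminates the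
      unknown \<open>l\<close> from the other equations.\<close>
    define a' where "a' = (\<lambda>j' i. a j' i * a j l - a j' l * a j i)"
    have "card J < card I'" "finite I'"
      using insert.prems insert.hyps l by (auto simp: I'_def)
    moreover have "a' j' i \<in> S" if "j' \<in> J" "i \<in> I'" for j' i
    proof -
      have "a j' i \<in> S" "a j l \<in> S" "a j' l \<in> S" "a j i \<in> S"
        using insert.prems(3) that l by (auto simp: I'_def)
      then have "a j' i * a j l + - (a j' l * a j i) \<in> S"
        using S unfolding ring_closed_def by blast
      then show ?thesis by (simp add: a'_def)
    qed
    ultimately obtain x where x: "\<forall>i\<in>I'. x i \<in> S" "\<exists>i\<in>I'. x i \<noteq> 0"
        "\<forall>j'\<in>J. (\<Sum>i\<in>I'. a' j' i * x i) = 0"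
      using insert.IH[of I' a'] by blast
    \<comment> \<open>Back substitution: all other unknowns are scaled by the pivot
      \<open>a j l\<close>, so that equation \<open>j\<close> can be solved for the unknown
      \<open>l\<close> without dividing.\<close>
    define z where "z = (\<lambda>i. if i = l then - (\<Sum>i\<in>I'. a j i * x i) else a j l * x i)"
    have split: "(\<Sum>i\<in>I. g i) = g l + (\<Sum>i\<in>I'. g i)" for g :: "'i \<Rightarrow> 'a"
      unfolding I'_def using insert.prems(1) l(1) by (simp add: sum.remove)
    have z': "z i = a j l * x i" if "i \<in> I'" for i
      using that by (auto simp: z_def I'_def)
    have "\<forall>i\<in>I. z i \<in> S"
    proof
      fix i assume i: "i \<in> I"
      have "(\<Sum>i\<in>I'. a j i * x i) \<in> S"
        using S x(1) insert.prems(3) by (intro ring_closed_sum) (auto simp: ring_closed_def I'_def)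
      moreover have "i \<noteq> l \<Longrightarrow> a j l * x i \<in> S"
        using S x(1) insert.prems(3) l i by (auto simp: ring_closed_def I'_def)
      ultimately show "z i \<in> S"
        using S by (auto simp: z_def ring_closed_def)
    qed
    moreover have "\<exists>i\<in>I. z i \<noteq> 0"
    proof -
      obtain i where "i \<in> I'" "x i \<noteq> 0" using x(2) by blast
      then show ?thesis using z' l by (intro bexI[of _ i]) (auto simp: I'_def)
    qed
    moreover have "(\<Sum>i\<in>I. a j' i * z i) = 0" if "j' \<in> insert j J" for j'
    proof -
      have "(\<Sum>i\<in>I. a j' i * z i) = a j' l * z l + (\<Sum>i\<in>I'. a j' i * (a j l * x i))"
        by (subst split) (simp add: z')
      also have "\<dots> = (\<Sum>i\<in>I'. a' j' i * x i)"
        by (simp add: z_def a'_def sum_distrib_left algebra_simps sum_subtractf)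
      finally have "(\<Sum>i\<in>I. a j' i * z i) = (\<Sum>i\<in>I'. a' j' i * x i)" .
      then show ?thesis using that x(3) by (auto simp: a'_def mult.commute)
    qed
    ultimately show ?thesis by blast
  qed
qed

lemma ring_closed_UNIV: "ring_closed UNIV"
  by (simp add: ring_closed_def)

lemma ring_closed_Rats: "ring_closed (\<rat> :: 'a::field_char_0 set)"
  by (simp add: ring_closed_def)

text \<open>There is one more vector than there are coordinates. Cutting the relation at its last
  nonzero coefficient makes \<open>r s\<close> nonzero, as needed for the leading coefficient of a
  recurrence.\<close>

lemma polynomial_vectors_dependent:
  fixes v :: "nat \<Rightarrow> 'i \<Rightarrow> 'a::idom poly"
  assumes "finite I"
  shows "\<exists>r s. r s \<noteq> 0 \<and> (\<forall>j\<in>I. (\<Sum>i\<le>s. r i * v i j) = 0)"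
proof -
  obtain r where r: "\<exists>i\<in>{..card I}. r i \<noteq> 0" "\<forall>j\<in>I. (\<Sum>i\<le>card I. v i j * r i) = 0"
    using homogeneous_system_solution[OF ring_closed_UNIV assms, of "{..card I}" "\<lambda>j i. v i j"]
    by auto
  define s where "s = Max {i\<in>{..card I}. r i \<noteq> 0}"
  have s: "s \<in> {i\<in>{..card I}. r i \<noteq> 0}"
    unfolding s_def by (rule Max_in) (use r(1) in auto)
  have "r i = 0" if "i \<le> card I" "i > s" for i
  proof (rule ccontr)
    assume "r i \<noteq> 0"
    then have "i \<le> s" unfolding s_def by (intro Max_ge) (use that in auto)
    then show False using that by simp
  qed
  then have "(\<Sum>i\<le>s. r i * v i j) = (\<Sum>i\<le>card I. v i j * r i)" for j
    using s by (intro sum.mono_neutral_cong_left) (auto simp: mult.commute)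
  then show ?thesis using r(2) s by (intro exI[of _ r] exI[of _ s]) auto
qed

section \<open>Denominators\<close>

lemma common_denominator:
  fixes S :: "real set"
  assumes "finite S" "S \<subseteq> \<rat>"
  shows "\<exists>E::nat. E > 0 \<and> (\<forall>x\<in>S. real E * x \<in> \<int>)"
  using assms
proof (induction S rule: finite_induct)
  case empty
  then show ?case by (intro exI[of _ 1]) auto
next
  case (insert x S)
  then obtain E :: nat where E: "E > 0" "\<forall>x\<in>S. real E * x \<in> \<int>" by auto
  obtain p :: int and q :: nat where pq: "q > 0" "x = of_int p / of_nat q"
    using insert.prems by (auto simp: Rats_eq_int_div_nat)
  have "real (E * q) * x = of_int (int E * p)" using pq by simp
  moreover have "real (E * q) * z \<in> \<int>" if "z \<in> S" for z
  proof -
    have "real q * (real E * z) \<in> \<int>" using E(2) that by (metis Ints_mult Ints_of_nat)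
    then show ?thesis by (simp add: algebra_simps)
  qed
  ultimately show ?case using E pq by (intro exI[of _ "E * q"]) (auto simp del: of_nat_mult)
qed

text \<open>\<open>E\<close> clears the coefficients and \<open>B ^ N\<close> the powers of
  \<open>1 / B\<close>. It matters that \<open>E\<close> does not depend on \<open>B\<close>, since
  \<open>B\<close> will run through the numbers \<open>b ^ (k ^ n)\<close>.\<close>

lemma rational_poly_denominator:
  fixes p :: "'i \<Rightarrow> real poly"
  assumes "finite I" "\<And>i n. i \<in> I \<Longrightarrow> coeff (p i) n \<in> \<rat>" "\<And>i. i \<in> I \<Longrightarrow> degree (p i) \<le> N"
  shows "\<exists>E::nat. E > 0 \<and> (\<forall>i\<in>I. \<forall>B>0. real E * real B ^ N * poly (p i) (1 / real B) \<in> \<int>)"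
proof -
  have "finite ((\<lambda>(i, n). coeff (p i) n) ` (I \<times> {..N}))"
    "(\<lambda>(i, n). coeff (p i) n) ` (I \<times> {..N}) \<subseteq> \<rat>"
    using assms by auto
  then obtain E :: nat where E: "E > 0" "\<And>i n. i \<in> I \<Longrightarrow> n \<le> N \<Longrightarrow> real E * coeff (p i) n \<in> \<int>"
    using common_denominator by (smt (verit) SigmaI atMost_iff case_prod_conv image_eqI)
  have "real E * real B ^ N * poly (p i) (1 / real B) \<in> \<int>" if "i \<in> I" "B > 0" for i and B :: nat
  proof -
    have "poly (p i) (1 / real B) = (\<Sum>n\<le>N. coeff (p i) n * (1 / real B) ^ n)"
      unfolding poly_altdef using assms(3)[OF that(1)]
      by (intro sum.mono_neutral_left) (auto simp: coeff_eq_0)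
    then have "real E * real B ^ N * poly (p i) (1 / real B)
        = (\<Sum>n\<le>N. (real E * coeff (p i) n) * (real B ^ N * (1 / real B) ^ n))"
      by (simp add: sum_distrib_left mult_ac)
    also have "\<dots> = (\<Sum>n\<le>N. (real E * coeff (p i) n) * of_nat B ^ (N - n))"
      using that(2) by (intro sum.cong) (auto simp: power_diff power_divide)
    also have "\<dots> \<in> \<int>"
      by (intro Ints_sum Ints_mult E(2) that Ints_power Ints_of_nat) auto
    finally show ?thesis .
  qed
  then show ?thesis using E(1) by blast
qed

lemma poly_bounded_unit:
  fixes p :: "real poly"
  shows "\<exists>C\<ge>0. \<forall>x. \<bar>x\<bar> \<le> 1 \<longrightarrow> \<bar>poly p x\<bar> \<le> C"
proof -
  have "\<bar>poly p x\<bar> \<le> (\<Sum>i\<le>degree p. \<bar>coeff p i\<bar>)" if "\<bar>x\<bar> \<le> 1" for x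
  proof -
    have "\<bar>poly p x\<bar> \<le> (\<Sum>i\<le>degree p. \<bar>coeff p i * x ^ i\<bar>)"
      unfolding poly_altdef by (rule sum_abs)
    also have "\<dots> \<le> (\<Sum>i\<le>degree p. \<bar>coeff p i\<bar>)"
      using that by (intro sum_mono) (auto simp: abs_mult power_abs mult_left_le power_le_one)
    finally show ?thesis .
  qed
  then show ?thesis by (intro exI[of _ "\<Sum>i\<le>degree p. \<bar>coeff p i\<bar>"]) (auto intro: sum_nonneg)
qed

section \<open>Simultaneous rational approximation of power series\<close>

text \<open>After the factor \<open>fps_X ^ V\<close> is split off, the cofactor is continuous on
  the compact interval [-1/2, 1/2], which lies inside its disc of convergence and will contain all
  evaluation points.\<close>

lemma fps_eval_vanishing_bound:
  fixes w :: "real fps"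
  assumes "fps_conv_radius w \<ge> 1" "\<And>n. n < V \<Longrightarrow> fps_nth w n = 0"
  shows "\<exists>K\<ge>0. \<forall>x. \<bar>x\<bar> \<le> 1/2 \<longrightarrow> \<bar>eval_fps w x\<bar> \<le> K * \<bar>x\<bar> ^ V"
proof -
  define R where "R = fps_shift V w"
  have half: "ereal \<bar>x\<bar> < 1" if "\<bar>x\<bar> \<le> 1/2" for x :: real
    using that by (simp add: one_ereal_def)
  have rR: "fps_conv_radius R \<ge> 1" using assms by (simp add: R_def)
  have w: "w = fps_X ^ V * R"
    by (rule fps_ext) (use assms(2) in \<open>auto simp: R_def fps_X_power_mult_nth\<close>)
  have "compact (eval_fps R ` {-1/2..1/2})"
  proof (intro compact_continuous_image compact_Icc continuous_on_eval_fps')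
    show "continuous_on {- 1 / 2..1 / 2} (\<lambda>x::real. x)" by simp
    show "(\<lambda>x::real. x) ` {- 1 / 2..1 / 2} \<subseteq> eball 0 (fps_conv_radius R)"
      using less_le_trans[OF half rR] by (auto simp: dist_norm abs_le_iff)
  qed
  then have "bounded (eval_fps R ` {-1/2..1/2})" by (rule compact_imp_bounded)
  then obtain K where K: "\<And>x. x \<in> {-1/2..1/2} \<Longrightarrow> \<bar>eval_fps R x\<bar> \<le> K"
    unfolding bounded_iff by (metis imageI real_norm_def)
  have "\<bar>eval_fps w x\<bar> \<le> max K 0 * \<bar>x\<bar> ^ V" if "\<bar>x\<bar> \<le> 1/2" for x
  proof -
    have "eval_fps w x = eval_fps (fps_X ^ V) x * eval_fps R x"
      unfolding w using less_le_trans[OF half[OF that] rR] by (subst eval_fps_mult) auto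
    then have "\<bar>eval_fps w x\<bar> = \<bar>eval_fps R x\<bar> * \<bar>x\<bar> ^ V"
      by (simp add: abs_mult power_abs)
    moreover have "\<bar>eval_fps R x\<bar> \<le> max K 0"
      using that by (intro max.coboundedI1 K) (auto simp: abs_if split: if_splits)
    ultimately show ?thesis by (simp add: mult_right_mono)
  qed
  then show ?thesis by (intro exI[of _ "max K 0"]) auto
qed

text \<open>The \<open>N + 1\<close> coefficients of \<open>q\<close> are the unknowns; the
  \<open>card I * T\<close> equations kill the coefficients of every \<open>q * H i\<close> in
  degrees \<open>N + 1\<close> to \<open>N + T\<close>. Then \<open>p i\<close> is the truncation of
  \<open>q * H i\<close> at degree \<open>N\<close>.\<close>

lemma simultaneous_pade:
  fixes H :: "'i \<Rightarrow> real fps"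
  assumes "finite I" "\<And>i n. i \<in> I \<Longrightarrow> fps_nth (H i) n \<in> \<rat>" "card I * T \<le> N"
  shows "\<exists>q p. q \<noteq> 0 \<and> degree q \<le> N \<and> (\<forall>n. coeff q n \<in> \<rat>) \<and>
    (\<forall>i\<in>I. degree (p i) \<le> N \<and> (\<forall>n. coeff (p i) n \<in> \<rat>) \<and>
       (\<forall>n<N + T. fps_nth (fps_of_poly q * H i - fps_of_poly (p i)) n = 0))"
proof -
  \<comment> \<open>The factor of the unknown \<open>z l\<close> in the \<open>n\<close>-th
    coefficient of \<open>q * H i\<close>; the value 0 for \<open>l > n\<close> guards against
    truncated subtraction.\<close>
  define a where "a = (\<lambda>(i, n) l. if l \<le> n then fps_nth (H i) (n - l) else 0)"
  have "\<exists>z. (\<forall>l\<in>{..N}. z l \<in> \<rat>) \<and> (\<exists>l\<in>{..N}. z l \<noteq> 0) \<and>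
      (\<forall>j\<in>I \<times> {N<..N+T}. (\<Sum>l\<le>N. a j l * z l) = 0)"
    by (intro homogeneous_system_solution ring_closed_Rats)
       (use assms in \<open>auto simp: a_def card_cartesian_product\<close>)
  then obtain z where z0: "\<forall>l\<in>{..N}. z l \<in> \<rat>" "\<exists>l\<in>{..N}. z l \<noteq> 0"
      "\<forall>j\<in>I \<times> {N<..N+T}. (\<Sum>l\<le>N. a j l * z l) = 0"
    by blast
  have z: "\<And>l. l \<le> N \<Longrightarrow> z l \<in> \<rat>" "\<exists>l\<le>N. z l \<noteq> 0"
      "\<And>i n. i \<in> I \<Longrightarrow> N < n \<Longrightarrow> n \<le> N + T \<Longrightarrow> (\<Sum>l\<le>N. a (i, n) l * z l) = 0"
    using z0 by auto
  define q where "q = (\<Sum>l\<le>N. monom (z l) l)"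
  have cq: "coeff q l = (if l \<le> N then z l else 0)" for l
    by (simp add: q_def coeff_sum coeff_monom)
  define p where "p = (\<lambda>i. \<Sum>l\<le>N. monom (fps_nth (fps_of_poly q * H i) l) l)"
  have cp: "coeff (p i) l = (if l \<le> N then fps_nth (fps_of_poly q * H i) l else 0)" for i l
    by (simp add: p_def coeff_sum coeff_monom)
  have prod: "fps_nth (fps_of_poly q * H i) n = (\<Sum>l\<le>N. a (i, n) l * z l)" for i n
  proof -
    have "fps_nth (fps_of_poly q * H i) n = (\<Sum>l\<le>n. if l \<le> N then fps_nth (H i) (n - l) * z l else 0)"
      by (auto simp: fps_mult_nth atLeast0AtMost cq intro!: sum.cong)
    also have "\<dots> = (\<Sum>l\<in>{..n} \<inter> {..N}. fps_nth (H i) (n - l) * z l)"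
      by (subst sum.inter_restrict) auto
    also have "\<dots> = (\<Sum>l\<in>{..N} \<inter> {..n}. fps_nth (H i) (n - l) * z l)"
      by (simp add: Int_commute)
    also have "\<dots> = (\<Sum>l\<le>N. a (i, n) l * z l)"
      unfolding a_def by (subst sum.inter_restrict) (auto intro!: sum.cong)
    finally show ?thesis .
  qed
  have "q \<noteq> 0" using z(2) cq by (metis coeff_0)
  moreover have "degree q \<le> N" by (intro degree_le) (auto simp: cq)
  moreover have "\<forall>n. coeff q n \<in> \<rat>" by (auto simp: cq z)
  moreover have "degree (p i) \<le> N" for i by (intro degree_le) (auto simp: cp)
  moreover have "coeff (p i) n \<in> \<rat>" if "i \<in> I" for i n
    using assms(2)[OF that] z(1) by (auto simp: cp prod a_def intro!: Rats_mult ring_closed_sum ring_closed_Rats)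
  moreover have "fps_nth (fps_of_poly q * H i - fps_of_poly (p i)) n = 0" if "i \<in> I" "n < N + T" for i n
    using z(3)[OF that(1), of n] that(2) by (auto simp: cp prod)
  ultimately show ?thesis by blast
qed

section \<open>Linear forms in the values of a Mahler system\<close>

text \<open>The functional equation is imposed on values in the unit disc, the form in which it is
  iterated along the points and multiplied to obtain product systems.\<close>

locale mahler_system =
  fixes k b :: nat and I :: "'i set" and H :: "'i \<Rightarrow> real fps" and A :: "'i \<Rightarrow> 'i \<Rightarrow> real poly"
  assumes k: "k \<ge> 2" and b: "b \<ge> 2" and fin: "finite I"
    and H_rat: "\<And>i n. i \<in> I \<Longrightarrow> fps_nth (H i) n \<in> \<rat>"
    and H_radius: "\<And>i. i \<in> I \<Longrightarrow> fps_conv_radius (H i) \<ge> 1"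
    and A_rat: "\<And>i j n. i \<in> I \<Longrightarrow> j \<in> I \<Longrightarrow> coeff (A i j) n \<in> \<rat>"
    and functional_eq: "\<And>i x. i \<in> I \<Longrightarrow> \<bar>x\<bar> < 1 \<Longrightarrow>
      eval_fps (H i) x = (\<Sum>j\<in>I. poly (A i j) x * eval_fps (H j) (x ^ k))"
begin

section \<open>Transport of a linear form along the points b^(-k^n)\<close>

definition X :: "nat \<Rightarrow> real" where
  "X n = real b ^ (k ^ n)"

abbreviation pt :: "nat \<Rightarrow> real" where
  "pt n \<equiv> 1 / X n"

text \<open>The row vector \<open>c\<close> multiplied on the right by the matrices \<open>A\<close>
  at \<open>pt 0\<close>, ..., \<open>pt (n - 1)\<close>.\<close>

primrec pull :: "('i \<Rightarrow> real) \<Rightarrow> nat \<Rightarrow> 'i \<Rightarrow> real" where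
  "pull c 0 = c"
| "pull c (Suc n) = (\<lambda>j. \<Sum>i\<in>I. pull c n i * poly (A i j) (pt n))"

definition form :: "('i \<Rightarrow> real) \<Rightarrow> real" where
  "form c = (\<Sum>j\<in>I. c j * eval_fps (H j) (1 / real b))"

lemma X_add: "X (n + m) = X n ^ (k ^ m)"
  by (simp add: X_def power_add power_mult)

lemma X_Suc: "X (Suc n) = X n ^ k"
  using X_add[of n 1] by simp

lemma pt_Suc: "pt (Suc n) = pt n ^ k"
  by (simp add: X_Suc power_divide)

lemma X_mono: "m \<le> n \<Longrightarrow> X m \<le> X n"
  unfolding X_def using b k by (intro power_increasing) auto

lemma X_ge_two_power: "2 ^ n \<le> X n"
proof -
  have "n \<le> k ^ n"
    using k by (metis less_exp less_imp_le order_trans power_mono zero_le)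
  then have "(2::real) ^ n \<le> 2 ^ (k ^ n)" by (intro power_increasing) auto
  also have "\<dots> \<le> X n" unfolding X_def using b by (intro power_mono) auto
  finally show ?thesis .
qed

lemma X_ge_2: "X n \<ge> 2"
proof -
  have "(2::real) \<le> real b ^ 1" using b by simp
  also have "\<dots> \<le> X n" unfolding X_def using b k by (intro power_increasing) auto
  finally show ?thesis .
qed

lemma X_pos: "X n > 0"
  using X_ge_2[of n] by simp

lemma abs_pt: "\<bar>pt n\<bar> \<le> 1 / 2" "\<bar>pt n\<bar> \<le> 1" "\<bar>pt n\<bar> < 1"
  using X_ge_2[of n] X_pos[of n] by (auto simp: field_simps)

text \<open>\<open>X n\<close> grows doubly exponentially, so geometric factors from norms and
  denominators cost only a fixed power of \<open>X n\<close>.\<close>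

lemma power_le_X_power: "\<exists>a. \<forall>n. C ^ n \<le> X n ^ a" if "C \<ge> 0" for C :: real
proof -
  obtain a where a: "C < 2 ^ a" using real_arch_pow[of 2 C] by auto
  have "C ^ n \<le> X n ^ a" for n
  proof -
    have "C ^ n \<le> (2 ^ a) ^ n" using a that by (intro power_mono) auto
    also have "\<dots> = (2 ^ n) ^ a" by (simp flip: power_mult add: mult.commute)
    also have "\<dots> \<le> X n ^ a" using X_ge_two_power by (intro power_mono) auto
    finally show ?thesis .
  qed
  then show ?thesis by blast
qed

lemma form_pull: "(\<Sum>j\<in>I. pull c n j * eval_fps (H j) (pt n)) = form c"
proof (induction n)
  case 0
  then show ?case by (simp add: form_def X_def)
next
  case (Suc n)
  have "(\<Sum>j\<in>I. pull c (Suc n) j * eval_fps (H j) (pt (Suc n)))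
      = (\<Sum>j\<in>I. \<Sum>i\<in>I. pull c n i * (poly (A i j) (pt n) * eval_fps (H j) (pt n ^ k)))"
    unfolding pt_Suc by (simp add: sum_distrib_right mult.assoc)
  also have "\<dots> = (\<Sum>i\<in>I. \<Sum>j\<in>I. pull c n i * (poly (A i j) (pt n) * eval_fps (H j) (pt n ^ k)))"
    by (rule sum.swap)
  also have "\<dots> = (\<Sum>i\<in>I. pull c n i * eval_fps (H i) (pt n))"
    by (intro sum.cong refl) (simp only: functional_eq[OF _ abs_pt(3)] sum_distrib_left)
  finally show ?case using Suc by simp
qed

text \<open>Each step multiplies the size by at most \<open>C\<close>, the sum of bounds for all
  entries of \<open>A\<close> on [-1, 1]. The resulting \<open>C ^ n\<close> is absorbed into
  \<open>X n ^ a\<close>, with \<open>a\<close> independent of the form and of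
  \<open>n\<close>.\<close>

lemma pull_bound:
  "\<exists>a. \<forall>c h n. (\<forall>j\<in>I. \<bar>c j\<bar> \<le> h) \<longrightarrow> (\<forall>j\<in>I. \<bar>pull c n j\<bar> \<le> h * X n ^ a)"
proof -
  have "\<exists>B'. \<forall>p. B' p \<ge> 0 \<and> (\<forall>x. \<bar>x\<bar> \<le> 1 \<longrightarrow> \<bar>poly p x\<bar> \<le> (B' p :: real))"
    by (intro choice allI poly_bounded_unit)
  then obtain B' where B': "\<forall>p. B' p \<ge> 0 \<and> (\<forall>x. \<bar>x\<bar> \<le> 1 \<longrightarrow> \<bar>poly p x\<bar> \<le> (B' p :: real))"
    by (elim exE)
  define B where "B = (\<lambda>i j. B' (A i j))"
  have B: "\<And>i j. B i j \<ge> 0" "\<And>i j x. \<bar>x\<bar> \<le> 1 \<Longrightarrow> \<bar>poly (A i j) x\<bar> \<le> B i j"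
    using B' by (auto simp: B_def)
  define C where "C = (\<Sum>i\<in>I. \<Sum>j\<in>I. B i j)"
  have C: "(\<Sum>i\<in>I. B i j) \<le> C" if "j \<in> I" for j
    unfolding C_def using fin B(1) that by (intro sum_mono member_le_sum) auto
  have "C \<ge> 0" unfolding C_def using B(1) by (intro sum_nonneg) auto
  then obtain a where a: "\<And>n. C ^ n \<le> X n ^ a" using power_le_X_power by blast
  have "\<bar>pull c n j\<bar> \<le> h * C ^ n" if c: "\<forall>j\<in>I. \<bar>c j\<bar> \<le> h" and "j \<in> I" for c h n j
    using that(2)
  proof (induction n arbitrary: j)
    case 0
    then show ?case using c by simp
  next
    case (Suc n)
    have h: "h * C ^ n \<ge> 0" using Suc.IH[OF Suc.prems] by linarith
    have "\<bar>pull c (Suc n) j\<bar> \<le> (\<Sum>i\<in>I. \<bar>pull c n i * poly (A i j) (pt n)\<bar>)"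
      unfolding pull.simps by (rule sum_abs)
    also have "\<dots> \<le> (\<Sum>i\<in>I. (h * C ^ n) * B i j)"
      unfolding abs_mult using Suc.IH B abs_pt(2) h by (intro sum_mono mult_mono) auto
    also have "\<dots> = (h * C ^ n) * (\<Sum>i\<in>I. B i j)" by (simp add: sum_distrib_left)
    also have "\<dots> \<le> (h * C ^ n) * C" using C[OF Suc.prems] h by (intro mult_left_mono) auto
    finally show ?case by (simp add: mult_ac)
  qed
  moreover have "h * C ^ n \<le> h * X n ^ a" if "\<forall>j\<in>I. \<bar>c j\<bar> \<le> h" "j \<in> I"
    for c :: "'i \<Rightarrow> real" and h n j
    using a that by (intro mult_left_mono) force+
  ultimately show ?thesis by (meson order_trans)
qed

text \<open>The powers of the earlier \<open>X i\<close> do not accumulate: \<open>X (Suc n)\<close>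
  is a multiple of \<open>X n ^ 2\<close>, so the same exponent \<open>d\<close> works for every
  \<open>n\<close>.\<close>

lemma pull_denominator:
  "\<exists>Q d. Q > 0 \<and> (\<forall>c n. (\<forall>j\<in>I. c j \<in> \<int>) \<longrightarrow>
     (\<forall>j\<in>I. real Q ^ n * X n ^ d * pull c n j \<in> \<int>))"
proof -
  define d where "d = (\<Sum>i\<in>I. \<Sum>j\<in>I. degree (A i j))"
  have "degree (A i j) \<le> d" if "i \<in> I" "j \<in> I" for i j
  proof -
    have "degree (A i j) \<le> (\<Sum>j\<in>I. degree (A i j))"
      using that fin by (intro member_le_sum) auto
    also have "\<dots> \<le> d" unfolding d_def
      by (rule member_le_sum[where f = "\<lambda>i. \<Sum>j\<in>I. degree (A i j)"]) (use that fin in auto)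
    finally show ?thesis .
  qed
  then obtain Q :: nat where Q: "Q > 0" "\<And>i j B. i \<in> I \<Longrightarrow> j \<in> I \<Longrightarrow> B > 0 \<Longrightarrow>
      real Q * real B ^ d * poly (A i j) (1 / real B) \<in> \<int>"
    using rational_poly_denominator[of "I \<times> I" "\<lambda>(i, j). A i j" d] fin A_rat by auto
  have "real Q ^ n * X n ^ d * pull c n j \<in> \<int>" if c: "\<forall>j\<in>I. c j \<in> \<int>" and "j \<in> I" for c n j
    using that(2)
  proof (induction n arbitrary: j)
    case 0
    then show ?case using c by (auto simp: X_def intro!: Ints_mult Ints_power)
  next
    case (Suc n)
    \<comment> \<open>This uses \<open>k \<ge> 2\<close>: one factor \<open>X n ^ d\<close> clears
      the denominators of \<open>pull c n\<close>, the other those of \<open>A\<close> at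
      \<open>pt n\<close>.\<close>
    have "X (Suc n) = X n ^ (k - 2) * (X n * X n)"
      unfolding X_Suc power2_eq_square[symmetric] power_add[symmetric] le_add_diff_inverse2[OF k] ..
    then have "real Q ^ Suc n * X (Suc n) ^ d * pull c (Suc n) j =
       (X n ^ (k - 2)) ^ d *
         (\<Sum>i\<in>I. (real Q ^ n * X n ^ d * pull c n i) * (real Q * X n ^ d * poly (A i j) (pt n)))"
      by (simp add: power_mult_distrib sum_distrib_left mult_ac)
    moreover have "real Q * X n ^ d * poly (A i j) (pt n) \<in> \<int>" if "i \<in> I" for i
      using Q(2)[OF that Suc.prems, of "b ^ (k ^ n)"] b by (simp add: X_def)
    moreover have "(X n ^ (k - 2)) ^ d \<in> \<int>" by (auto simp: X_def intro!: Ints_power)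
    ultimately show ?case
      using Suc.IH by (metis (no_types, lifting) Ints_mult Ints_sum)
  qed
  then show ?thesis using Q(1) by blast
qed

section \<open>Recurrence for the approximating values and propagation of zeros\<close>

lemma poly_pt_nonzero_eventually:
  fixes p :: "real poly"
  assumes "p \<noteq> 0"
  shows "\<exists>n1. \<forall>n\<ge>n1. poly p (pt n) \<noteq> 0"
proof -
  have "inj X"
    unfolding X_def inj_def using b k by (auto simp: power_inject_exp)
  then have "inj pt" by (simp add: inj_def)
  then have "finite (pt -` {x. poly p x = 0})"
    using poly_roots_finite[OF assms] finite_vimageI by blast
  then obtain n1 where "pt -` {x. poly p x = 0} \<subseteq> {..<n1}"
    using finite_nat_bounded by blast
  then show ?thesis by (intro exI[of _ n1]) auto
qed

text \<open>The columns obtained from \<open>p\<close> by iterating \<open>v \<mapsto> A(x) v(x\<^sup>k)\<close> are linearly dependent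
  over the polynomials; this turns into a recurrence whose coefficients do not depend on the
  linear form.\<close>

lemma pull_recurrence:
  fixes p :: "'i \<Rightarrow> real poly"
  defines "y \<equiv> \<lambda>c n. \<Sum>j\<in>I. pull c n j * poly (p j) (pt n)"
  shows "\<exists>r s. r s \<noteq> 0 \<and> (\<forall>c n. (\<Sum>i\<le>s. poly (r i) (pt n) * y c (n + i)) = 0)"
proof -
  define v where "v = rec_nat p (\<lambda>_ w i. \<Sum>j\<in>I. A i j * pcompose (w j) (monom 1 k))"
  have v: "v 0 = p" "\<And>l. v (Suc l) = (\<lambda>i. \<Sum>j\<in>I. A i j * pcompose (v l j) (monom 1 k))"
    by (simp_all add: v_def)
  \<comment> \<open>As \<open>pt n ^ k\<close> is \<open>pt (Suc n)\<close>, pairing the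
    \<open>l\<close>-th column at \<open>pt n\<close> with \<open>pull c n\<close> shifts the index
    of \<open>y\<close> by \<open>l\<close>.\<close>
  have y: "(\<Sum>j\<in>I. pull c n j * poly (v l j) (pt n)) = y c (n + l)" for c n l
  proof (induction l arbitrary: n)
    case 0
    then show ?case by (simp add: v y_def)
  next
    case (Suc l)
    have "(\<Sum>i\<in>I. pull c n i * poly (v (Suc l) i) (pt n))
        = (\<Sum>i\<in>I. \<Sum>j\<in>I. pull c n i * poly (A i j) (pt n) * poly (v l j) (pt (Suc n)))"
      unfolding pt_Suc
      by (simp add: v poly_sum poly_pcompose poly_monom sum_distrib_left mult.assoc)
    also have "\<dots> = (\<Sum>j\<in>I. pull c (Suc n) j * poly (v l j) (pt (Suc n)))"
      by (subst sum.swap) (simp add: sum_distrib_right)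
    finally show ?case using Suc[of "Suc n"] by simp
  qed
  obtain r s where rs: "r s \<noteq> 0" "\<forall>j\<in>I. (\<Sum>i\<le>s. r i * v i j) = 0"
    using polynomial_vectors_dependent[OF fin, of v] by blast
  have "(\<Sum>i\<le>s. poly (r i) (pt n) * y c (n + i)) = 0" for c n
  proof -
    have "(\<Sum>i\<le>s. poly (r i) (pt n) * y c (n + i))
        = (\<Sum>i\<le>s. \<Sum>j\<in>I. pull c n j * poly (r i * v i j) (pt n))"
      by (simp flip: y add: sum_distrib_left mult_ac)
    also have "\<dots> = (\<Sum>j\<in>I. pull c n j * poly (\<Sum>i\<le>s. r i * v i j) (pt n))"
      by (subst sum.swap) (simp add: poly_sum sum_distrib_left)
    also have "\<dots> = 0" using rs(2) by simp
    finally show ?thesis .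
  qed
  then show ?thesis using rs(1) by blast
qed

end

text \<open>From \<open>m\<close> on the leading coefficient does not vanish, so each value is
  determined by the \<open>s\<close> values before it.\<close>

lemma recurrence_zeros_propagate:
  fixes y :: "nat \<Rightarrow> real"
  assumes rec: "\<And>n. (\<Sum>i\<le>s. r i n * y (n + i)) = 0"
    and lead: "\<And>n. n \<ge> m \<Longrightarrow> r s n \<noteq> 0"
    and zeros: "\<And>n. m \<le> n \<Longrightarrow> n < m + s \<Longrightarrow> y n = 0"
    and "n \<ge> m"
  shows "y n = 0"
  using \<open>n \<ge> m\<close>
proof (induction n rule: less_induct)
  case (less n)
  show ?case
  proof (cases "n < m + s")
    case True
    then show ?thesis using zeros less.prems by blast
  next
    case False
    then have n: "n - s \<ge> m" "n - s + s = n" by auto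
    have "(\<Sum>i<s. r i (n - s) * y (n - s + i)) = 0"
      by (rule sum.neutral) (use n less.IH in auto)
    then have "r s (n - s) * y n = 0"
      using rec[of "n - s"] n(2) by (simp add: lessThan_Suc_atMost[symmetric] flip: add.commute)
    then show ?thesis using lead[OF n(1)] by simp
  qed
qed

section \<open>Lower bound for nonzero linear forms\<close>

context mahler_system
begin

text \<open>\<open>C\<close> and \<open>W\<close> depend only on the system. The index
  \<open>n\<close> is chosen with \<open>y c n\<close> nonzero and \<open>X n\<close> between a
  multiple of \<open>h\<close> and a constant times a fixed power of \<open>h\<close>; the
  approximation error is then at most half the lower bound for the absolute value of
  \<open>y c n\<close>.\<close>

theorem linear_form_measure:
  "\<exists>C W. C > 0 \<and> (\<forall>c h. (\<forall>j\<in>I. c j \<in> \<int> \<and> \<bar>c j\<bar> \<le> h) \<longrightarrow> h \<ge> 1 \<longrightarrow> form c \<noteq> 0 \<longrightarrow>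
     C \<le> \<bar>form c\<bar> * h ^ W)"
proof -
  obtain a1 where a1: "\<And>c h n j. \<forall>j\<in>I. \<bar>c j\<bar> \<le> h \<Longrightarrow> j \<in> I \<Longrightarrow> \<bar>pull c n j\<bar> \<le> h * X n ^ a1"
    using pull_bound by blast
  obtain Q :: nat and d where Q: "Q > 0" "\<And>c n j. \<forall>j\<in>I. c j \<in> \<int> \<Longrightarrow> j \<in> I \<Longrightarrow>
      real Q ^ n * X n ^ d * pull c n j \<in> \<int>"
    using pull_denominator by blast
  obtain a2 where a2: "\<And>n. real Q ^ n \<le> X n ^ a2" using power_le_X_power[of "real Q"] by auto
  \<comment> \<open>\<open>a1\<close> pays for the growth of \<open>pull\<close>,
    \<open>a2 + d\<close> for its denominators, and the final 1 leaves a spare factor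
    \<open>1 / X n\<close> to beat \<open>h\<close>.\<close>
  define T where "T = a1 + a2 + d + 1"
  define N where "N = card I * T"
  have "\<exists>q p. q \<noteq> 0 \<and> degree q \<le> N \<and> (\<forall>n. coeff q n \<in> \<rat>) \<and>
     (\<forall>i\<in>I. degree (p i) \<le> N \<and> (\<forall>n. coeff (p i) n \<in> \<rat>) \<and>
       (\<forall>n<N + T. fps_nth (fps_of_poly q * H i - fps_of_poly (p i)) n = 0))"
    by (rule simultaneous_pade) (use fin H_rat in \<open>auto simp: N_def\<close>)
  then obtain q p where qp:
    "q \<noteq> 0 \<and> degree q \<le> N \<and> (\<forall>n. coeff q n \<in> \<rat>) \<and>
     (\<forall>i\<in>I. degree (p i) \<le> N \<and> (\<forall>n. coeff (p i) n \<in> \<rat>) \<and>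
       (\<forall>n<N + T. fps_nth (fps_of_poly q * H i - fps_of_poly (p i)) n = 0))"
    by (elim exE)
  then have q: "q \<noteq> 0" "degree q \<le> N" "\<And>n. coeff q n \<in> \<rat>"
    and p: "\<And>i. i \<in> I \<Longrightarrow> degree (p i) \<le> N" "\<And>i n. i \<in> I \<Longrightarrow> coeff (p i) n \<in> \<rat>"
      "\<And>i n. i \<in> I \<Longrightarrow> n < N + T \<Longrightarrow> fps_nth (fps_of_poly q * H i - fps_of_poly (p i)) n = 0"
    by blast+
  obtain E :: nat where E: "E > 0" "\<And>i B. i \<in> I \<Longrightarrow> B > 0 \<Longrightarrow>
      real E * real B ^ N * poly (p i) (1 / real B) \<in> \<int>"
    using rational_poly_denominator[OF fin, of p N] p by auto
  obtain Eq :: nat where Eq: "Eq > 0" "\<And>B. B > 0 \<Longrightarrow> real Eq * real B ^ N * poly q (1 / real B) \<in> \<int>"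
    using rational_poly_denominator[of "{()}" "\<lambda>_. q" N] q by auto
  obtain Kq' where "\<And>x. \<bar>x\<bar> \<le> 1 \<Longrightarrow> \<bar>poly q x\<bar> \<le> Kq'" using poly_bounded_unit by metis
  then obtain Kq where Kq: "Kq \<ge> 1" "\<And>x. \<bar>x\<bar> \<le> 1 \<Longrightarrow> \<bar>poly q x\<bar> \<le> Kq"
    by (metis max.cobounded2 max.coboundedI1)
  have "\<exists>K\<ge>0. \<forall>x. \<bar>x\<bar> \<le> 1/2 \<longrightarrow> \<bar>poly q x * eval_fps (H i) x - poly (p i) x\<bar> \<le> K * \<bar>x\<bar> ^ (N + T)"
    if i: "i \<in> I" for i
  proof -
    let ?w = "fps_of_poly q * H i - fps_of_poly (p i)"
    have "fps_conv_radius (fps_of_poly q * H i) \<ge> 1"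
      using fps_conv_radius_mult[of "fps_of_poly q" "H i"] H_radius[OF i] by simp
    then have r: "fps_conv_radius ?w \<ge> 1"
      using fps_conv_radius_diff[of "fps_of_poly q * H i" "fps_of_poly (p i)"] by simp
    obtain K where K: "K \<ge> 0" "\<And>x. \<bar>x\<bar> \<le> 1/2 \<Longrightarrow> \<bar>eval_fps ?w x\<bar> \<le> K * \<bar>x\<bar> ^ (N + T)"
      using fps_eval_vanishing_bound[OF r p(3)[OF i]] by blast
    have "eval_fps ?w x = poly q x * eval_fps (H i) x - poly (p i) x" if "\<bar>x\<bar> \<le> 1/2" for x
    proof -
      have x: "ereal \<bar>x\<bar> < 1" using that by (simp add: one_ereal_def)
      then have "ereal \<bar>x\<bar> < fps_conv_radius (H i)" "ereal \<bar>x\<bar> < fps_conv_radius (fps_of_poly q * H i)"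
        using less_le_trans[OF x] H_radius[OF i] \<open>fps_conv_radius (fps_of_poly q * H i) \<ge> 1\<close>
        by blast+
      then show ?thesis by (simp add: eval_fps_diff eval_fps_mult)
    qed
    then show ?thesis using K by (intro exI[of _ K]) auto
  qed
  then obtain K where K: "\<And>i. i \<in> I \<Longrightarrow> K i \<ge> 0" "\<And>i x. i \<in> I \<Longrightarrow> \<bar>x\<bar> \<le> 1/2 \<Longrightarrow>
      \<bar>poly q x * eval_fps (H i) x - poly (p i) x\<bar> \<le> K i * \<bar>x\<bar> ^ (N + T)"
    by metis
  define K' where "K' = (\<Sum>i\<in>I. K i) + 1"
  have K': "K' \<ge> 1" using K(1) by (auto simp: K'_def intro: sum_nonneg)
  define y where "y = (\<lambda>c n. \<Sum>j\<in>I. pull c n j * poly (p j) (pt n))"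
  \<comment> \<open>\<open>E * X n ^ M\<close> bounds a denominator of \<open>y c n\<close>:
    \<open>N\<close> comes from the \<open>p j\<close>, \<open>a2 + d\<close> from
    \<open>pull\<close>.\<close>
  define M where "M = N + a2 + d"
  have err: "\<bar>poly q (pt n) * form c - y c n\<bar> \<le> K' * h / (X n ^ M * X n)"
    if c: "\<forall>j\<in>I. \<bar>c j\<bar> \<le> h" and h: "h \<ge> 1" for c h n
  proof -
    have diff: "poly q (pt n) * form c - y c n
        = (\<Sum>j\<in>I. pull c n j * (poly q (pt n) * eval_fps (H j) (pt n) - poly (p j) (pt n)))"
      unfolding form_pull[of c n, symmetric] y_def
      by (simp add: sum_distrib_left sum_subtractf algebra_simps)
    have "\<bar>poly q (pt n) * form c - y c n\<bar> \<le> (\<Sum>j\<in>I. \<bar>pull c n j\<bar> *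
        \<bar>poly q (pt n) * eval_fps (H j) (pt n) - poly (p j) (pt n)\<bar>)"
      unfolding diff abs_mult[symmetric] by (rule sum_abs)
    also have "\<dots> \<le> (\<Sum>j\<in>I. (h * X n ^ a1) * (K j * \<bar>pt n\<bar> ^ (N + T)))"
    proof (intro sum_mono mult_mono)
      show "0 \<le> h * X n ^ a1" using h X_pos[of n] by simp
    qed (simp_all only: a1[OF c] K(2)[OF _ abs_pt(1)] abs_ge_zero)
    also have "\<dots> = (\<Sum>j\<in>I. K j) * (h * X n ^ a1 * \<bar>pt n\<bar> ^ (N + T))"
      by (simp only: sum_distrib_left[symmetric] mult_ac)
         (simp only: sum_distrib_left sum_distrib_right mult_ac)
    also have "\<dots> \<le> K' * (h * X n ^ a1 * \<bar>pt n\<bar> ^ (N + T))"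
      using h X_pos[of n] by (intro mult_right_mono) (auto simp: K'_def)
    also have "\<dots> = K' * h / (X n ^ M * X n)"
    proof -
      \<comment> \<open>The exponent \<open>N + T\<close> equals \<open>a1 + M + 1\<close>; the part
        \<open>a1\<close> cancels the bound for \<open>pull\<close>.\<close>
      have "X n ^ (N + T) = X n ^ a1 * (X n ^ M * X n)"
        by (simp add: T_def M_def power_add)
      then have "\<bar>pt n\<bar> ^ (N + T) = 1 / (X n ^ a1 * (X n ^ M * X n))"
        using X_pos[of n] by (simp only: abs_of_pos zero_less_divide_1_iff power_one_over)
      then show ?thesis using X_pos[of n] by simp
    qed
    finally show ?thesis .
  qed
  \<comment> \<open>Clearing denominators turns a nonzero \<open>y c n\<close> into a nonzero
    integer.\<close>
  have lower: "\<bar>y c n\<bar> \<ge> 1 / (E * X n ^ M)"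
    if c: "\<forall>j\<in>I. c j \<in> \<int>" and "y c n \<noteq> 0" for c n
  proof -
    let ?D = "real E * X n ^ N * (real Q ^ n * X n ^ d)"
    have "?D * y c n = (\<Sum>j\<in>I. (real Q ^ n * X n ^ d * pull c n j) * (real E * X n ^ N * poly (p j) (pt n)))"
      unfolding y_def by (simp add: sum_distrib_left mult_ac)
    also have "\<dots> \<in> \<int>"
    proof (intro Ints_sum Ints_mult[OF Q(2)[OF c]])
      fix j assume "j \<in> I"
      then show "real E * X n ^ N * poly (p j) (pt n) \<in> \<int>"
        using E(2)[of j "b ^ (k ^ n)"] b by (simp add: X_def)
    qed
    finally have "?D * y c n \<in> \<int>" .
    moreover have D: "?D > 0" using E Q X_pos[of n] by simp
    ultimately have "\<bar>?D * y c n\<bar> \<ge> 1"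
      using that(2) E(1) Q(1) X_pos[of n] by (intro Ints_nonzero_abs_ge1) auto
    then have "1 \<le> \<bar>y c n\<bar> * ?D"
      unfolding abs_mult[of ?D] abs_of_pos[OF D] by (simp only: mult.commute)
    then have "1 / ?D \<le> \<bar>y c n\<bar>" by (simp only: pos_divide_le_eq[OF D])
    moreover have "?D \<le> E * X n ^ M"
    proof -
      have "?D = (E * X n ^ (N + d)) * real Q ^ n" by (simp add: power_add)
      also have "\<dots> \<le> (E * X n ^ (N + d)) * X n ^ a2"
        using a2 X_pos[of n] by (intro mult_left_mono) auto
      finally show ?thesis by (simp add: M_def power_add mult_ac)
    qed
    then have "1 / (E * X n ^ M) \<le> 1 / ?D" using D by (intro divide_left_mono) auto
    ultimately show ?thesis by linarith
  qed
  obtain r s where rs: "r s \<noteq> 0" "\<And>c n. (\<Sum>i\<le>s. poly (r i) (pt n) * y c (n + i)) = 0"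
    using pull_recurrence[of p] unfolding y_def by blast
  obtain n1 where n1: "\<And>n. n \<ge> n1 \<Longrightarrow> poly q (pt n) \<noteq> 0 \<and> poly (r s) (pt n) \<noteq> 0"
    using poly_pt_nonzero_eventually[OF q(1)] poly_pt_nonzero_eventually[OF rs(1)]
    by (metis max.boundedE)
  have nonvanishing: "\<exists>n. m \<le> n \<and> n < m + s \<and> y c n \<noteq> 0"
    if c: "\<forall>j\<in>I. \<bar>c j\<bar> \<le> h" and h: "h \<ge> 1" and L: "form c \<noteq> 0" and m: "m \<ge> n1" for c h m
  proof (rule ccontr)
    assume neg: "\<not> (\<exists>n. m \<le> n \<and> n < m + s \<and> y c n \<noteq> 0)"
    have zero: "y c n = 0" if "n \<ge> m" for n
      by (rule recurrence_zeros_propagate[where r = "\<lambda>i n. poly (r i) (pt n)" and s = s and m = m])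
         (use rs n1 m neg that in auto)
    \<comment> \<open>With \<open>y c n = 0\<close> the error bound applies to
      \<open>poly q (pt n) * form c\<close> itself, while \<open>poly q (pt n)\<close> is a nonzero
      rational with denominator at most \<open>Eq * X n ^ N\<close>. Letting \<open>n\<close> grow
      contradicts \<open>form c \<noteq> 0\<close>.\<close>
    have "\<bar>form c\<bar> * 2 ^ n \<le> Eq * (K' * h)" if n: "n \<ge> m" for n
    proof -
      have "real Eq * X n ^ N * poly q (pt n) \<in> \<int>"
        using Eq(2)[of "b ^ (k ^ n)"] b by (simp add: X_def)
      then have "\<bar>real Eq * X n ^ N * poly q (pt n)\<bar> \<ge> 1"
        using Eq(1) X_pos[of n] n1 m n by (intro Ints_nonzero_abs_ge1) auto
      then have "\<bar>form c\<bar> * 1 \<le> \<bar>form c\<bar> * \<bar>real Eq * X n ^ N * poly q (pt n)\<bar>"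
        by (intro mult_left_mono) auto
      also have "\<dots> = Eq * X n ^ N * \<bar>poly q (pt n) * form c\<bar>"
        using X_pos[of n] by (simp add: abs_mult)
      also have "\<dots> \<le> Eq * X n ^ N * (K' * h / (X n ^ M * X n))"
        using err[OF c h, of n] zero[OF n] X_pos[of n] by (intro mult_left_mono) auto
      also have "\<dots> = Eq * (K' * h) / (X n ^ (a2 + d) * X n)"
        using X_pos[of n] by (simp add: M_def power_add field_simps)
      also have "\<dots> \<le> Eq * (K' * h) / (1 * X n)"
        using X_ge_2[of n] K' h
        by (intro divide_left_mono mult_right_mono mult_pos_pos) (auto intro!: one_le_power)
      finally have "\<bar>form c\<bar> * X n \<le> Eq * (K' * h)" using X_pos[of n] by (simp add: field_simps)
      moreover have "\<bar>form c\<bar> * 2 ^ n \<le> \<bar>form c\<bar> * X n"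
        using X_ge_two_power by (intro mult_left_mono) auto
      ultimately show ?thesis by linarith
    qed
    note bound = this
    obtain n where "Eq * (K' * h) / \<bar>form c\<bar> < 2 ^ n" using real_arch_pow[of 2] by auto
    then have "Eq * (K' * h) < \<bar>form c\<bar> * 2 ^ n" using L by (simp add: field_simps)
    also have "\<dots> \<le> \<bar>form c\<bar> * 2 ^ max n m" by (intro mult_left_mono power_increasing) auto
    also have "\<dots> \<le> Eq * (K' * h)" by (rule bound) auto
    finally show False by simp
  qed
  \<comment> \<open>\<open>X n \<ge> G * h\<close> is exactly what brings the error below half of
    \<open>1 / (E * X n ^ M)\<close>.\<close>
  define G where "G = 2 * K' * E"
  \<comment> \<open>A nonzero \<open>y c n\<close> occurs with \<open>n < n0 + n1 + s\<close>, and
    \<open>X (n0 + n1 + s)\<close> is \<open>X n0 ^ P\<close>.\<close>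
  define P where "P = k ^ (n1 + s)"
  have G: "G \<ge> 1" using K' E(1) mult_mono[of 1 K' 1 "real E"] by (auto simp: G_def)
  have b1: "real b \<ge> 1" using b by simp
  define C where "C = 1 / (2 * E * Kq * (b * G ^ k) ^ (P * M))"
  have "C \<le> \<bar>form c\<bar> * h ^ (k * P * M)"
    if c: "\<forall>j\<in>I. c j \<in> \<int> \<and> \<bar>c j\<bar> \<le> h" and h: "h \<ge> 1" and L: "form c \<noteq> 0" for c h
  proof -
    have Gh: "G * h \<ge> 1" using G h mult_mono[of 1 G 1 h] by auto
    have ex: "\<exists>n. G * h \<le> X n"
      using real_arch_pow[of 2 "G * h"] X_ge_two_power by (meson less_imp_le one_less_numeral_iff order_trans semiring_norm(76))
    \<comment> \<open>Minimality also bounds \<open>X n0\<close> from above: the preceding value is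
      below \<open>G * h\<close>, and a step raises it to the power \<open>k\<close>. The factor
      \<open>b\<close> in that bound covers \<open>n0 = 0\<close>, where
      \<open>X 0 = b\<close>.\<close>
    define n0 where "n0 = (LEAST n. G * h \<le> X n)"
    have n0: "G * h \<le> X n0" unfolding n0_def using ex by (rule LeastI_ex)
    have X_n0: "X n0 \<le> b * (G * h) ^ k"
    proof (cases n0)
      case 0
      have "real b * 1 \<le> b * (G * h) ^ k" using Gh by (intro mult_left_mono one_le_power) auto
      then show ?thesis using 0 by (simp add: X_def)
    next
      case (Suc n')
      then have "\<not> G * h \<le> X n'"
        using not_less_Least[of n' "\<lambda>n. G * h \<le> X n"] by (simp flip: n0_def)
      then have "X n' ^ k \<le> (G * h) ^ k" using X_pos[of n'] by (intro power_mono) auto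
      also have "\<dots> \<le> b * (G * h) ^ k" using mult_right_mono[OF b1, of "(G * h) ^ k"] Gh by simp
      finally show ?thesis using Suc by (simp add: X_Suc)
    qed
    define m where "m = n0 + n1"
    have "m \<ge> n1" by (simp add: m_def)
    then obtain n where n: "m \<le> n" "n < m + s" "y c n \<noteq> 0"
      using nonvanishing[OF _ h L \<open>m \<ge> n1\<close>] c by auto
    have Xn: "G * h \<le> X n" using n0 X_mono[of n0 n] n by (simp add: m_def)
    have "K' * h / (X n ^ M * X n) \<le> 1 / (2 * E * X n ^ M)"
    proof -
      have "K' * h * (2 * E) \<le> X n" using Xn by (simp add: G_def mult_ac)
      then have "K' * h * (2 * E) * X n ^ M \<le> X n * X n ^ M"
        using X_pos[of n] by (intro mult_right_mono) auto
      then show ?thesis using X_pos[of n] E(1) by (simp add: frac_le_eq divide_le_eq le_divide_eq mult_ac)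
    qed
    moreover have "1 / (E * X n ^ M) = 2 * (1 / (2 * E * X n ^ M))" by simp
    moreover have "\<bar>poly q (pt n) * form c - y c n\<bar> \<le> K' * h / (X n ^ M * X n)"
      using c h by (intro err) auto
    moreover have "1 / (E * X n ^ M) \<le> \<bar>y c n\<bar>" using c n by (intro lower) auto
    moreover have "u \<le> \<bar>v\<bar>" if "e \<le> u" "w = 2 * u" "\<bar>v - z\<bar> \<le> e" "w \<le> \<bar>z\<bar>" for u v w e z :: real
      using that by linarith
    ultimately have "1 / (2 * E * X n ^ M) \<le> \<bar>poly q (pt n) * form c\<bar>" by blast
    also have "\<dots> \<le> Kq * \<bar>form c\<bar>"
      unfolding abs_mult using Kq(2) abs_pt(2) by (intro mult_right_mono) auto
    finally have "1 \<le> Kq * \<bar>form c\<bar> * (2 * E * X n ^ M)"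
      using E(1) X_pos[of n] by (subst (asm) pos_divide_le_eq) auto
    then have 1: "1 \<le> \<bar>form c\<bar> * (2 * E * Kq * X n ^ M)" by (simp add: mult_ac)
    have "X n \<le> X (n0 + (n1 + s))" using n by (intro X_mono) (auto simp: m_def)
    also have "\<dots> \<le> (b * (G * h) ^ k) ^ P"
      unfolding X_add P_def using X_n0 X_pos[of n0] by (intro power_mono) auto
    finally have "X n ^ M \<le> ((b * (G * h) ^ k) ^ P) ^ M"
      using X_pos[of n] by (intro power_mono) auto
    also have "\<dots> = (b * G ^ k) ^ (P * M) * h ^ (k * P * M)"
      by (simp add: power_mult_distrib flip: power_mult) (simp add: mult_ac)
    finally have "\<bar>form c\<bar> * (2 * E * Kq * X n ^ M)
        \<le> \<bar>form c\<bar> * (2 * E * Kq * ((b * G ^ k) ^ (P * M) * h ^ (k * P * M)))"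
      using Kq(1) by (intro mult_left_mono) auto
    with 1 have "1 \<le> (2 * E * Kq * (b * G ^ k) ^ (P * M)) * (\<bar>form c\<bar> * h ^ (k * P * M))"
      by (simp add: mult_ac)
    moreover have "2 * E * Kq * (b * G ^ k) ^ (P * M) > 0"
      using E(1) Kq(1) b1 G by auto
    ultimately show ?thesis
      unfolding C_def by (subst pos_divide_le_eq) (auto simp: mult.commute)
  qed
  moreover have "C > 0" unfolding C_def using E(1) Kq(1) b1 G by auto
  ultimately show ?thesis by blast
qed

end

section \<open>Regular sequences\<close>

text \<open>With \<open>n' = n div k\<close> one has \<open>n' + 1 \<le> 2/3 (n + 1)\<close>, so a degree \<open>e\<close> with
  \<open>(3/2) ^ e\<close> above the operator norms absorbs each step \<open>n \<mapsto> n div k\<close>.\<close>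

lemma linear_recursion_polynomial_growth:
  fixes I :: "(nat \<Rightarrow> real) set"
  assumes k: "k \<ge> 2" and fin: "finite I"
    and rec: "\<And>g n r. g \<in> I \<Longrightarrow> r < k \<Longrightarrow> g (k * n + r) = (\<Sum>h\<in>I. a g r h * h n)"
  shows "\<exists>B e. \<forall>g\<in>I. \<forall>n. \<bar>g n\<bar> \<le> B * real (n + 1) ^ e"
proof -
  define K where "K = (\<Sum>g\<in>I. \<Sum>r<k. \<Sum>h\<in>I. \<bar>a g r h\<bar>)"
  have K: "(\<Sum>h\<in>I. \<bar>a g r h\<bar>) \<le> K" if "g \<in> I" "r < k" for g r
  proof -
    have "(\<Sum>h\<in>I. \<bar>a g r h\<bar>) \<le> (\<Sum>r<k. \<Sum>h\<in>I. \<bar>a g r h\<bar>)"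
      by (rule member_le_sum[where f = "\<lambda>r. \<Sum>h\<in>I. \<bar>a g r h\<bar>"])
         (use that in \<open>auto intro: sum_nonneg\<close>)
    also have "\<dots> \<le> K" unfolding K_def
      by (rule member_le_sum[where f = "\<lambda>g. \<Sum>r<k. \<Sum>h\<in>I. \<bar>a g r h\<bar>"])
         (use that fin in \<open>auto intro!: sum_nonneg\<close>)
    finally show ?thesis .
  qed
  obtain e where e: "K < (3/2) ^ e" using real_arch_pow[of "3/2" K] by auto
  define B where "B = (\<Sum>g\<in>I. \<bar>g 0\<bar>)"
  have B: "B \<ge> 0" by (auto simp: B_def intro: sum_nonneg)
  have "\<bar>g n\<bar> \<le> B * real (n + 1) ^ e" if "g \<in> I" for g n
    using that
  proof (induction n arbitrary: g rule: less_induct)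
    case (less n)
    show ?case
    proof (cases "n = 0")
      case True
      then show ?thesis
        using member_le_sum[OF less.prems, of "\<lambda>g. \<bar>g 0\<bar>"] fin by (simp add: B_def)
    next
      case False
      define n' r where "n' = n div k" and "r = n mod k"
      have n: "n = k * n' + r" "r < k" "n' < n" using k False by (auto simp: n'_def r_def)
      have "2 * n' \<le> n" using n(1) mult_le_mono1[OF k, of n'] by linarith
      then have "3 * (n' + 1) \<le> 2 * (n + 1)" using False by presburger
      then have "real (3 * (n' + 1)) \<le> real (2 * (n + 1))" by (simp only: of_nat_le_iff)
      then have n': "real (n' + 1) \<le> 2/3 * real (n + 1)" by simp
      have "\<bar>g n\<bar> \<le> (\<Sum>h\<in>I. \<bar>a g r h\<bar> * \<bar>h n'\<bar>)"
        unfolding n(1) rec[OF less.prems n(2)] abs_mult[symmetric] by (rule sum_abs)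
      also have "\<dots> \<le> (\<Sum>h\<in>I. \<bar>a g r h\<bar> * (B * real (n' + 1) ^ e))"
        using less.IH[OF n(3)] by (intro sum_mono mult_left_mono) auto
      also have "\<dots> = (\<Sum>h\<in>I. \<bar>a g r h\<bar>) * (B * real (n' + 1) ^ e)"
        by (simp add: sum_distrib_right)
      also have "\<dots> \<le> (3/2) ^ e * (B * (2/3 * real (n + 1)) ^ e)"
        using K[OF less.prems n(2)] e B n' by (intro mult_mono mult_left_mono power_mono) auto
      also have "\<dots> = B * (3/2 * (2/3 * real (n + 1))) ^ e"
        by (simp only: power_mult_distrib mult.left_commute)
      also have "3/2 * (2/3 * real (n + 1)) = real (n + 1)" by simp
      finally show ?thesis .
    qed
  qed
  then show ?thesis by blast
qed

text \<open>Comparison with the series of \<open>(n + 1) ^ e * r ^ n\<close>, which has radius 1 by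
  the ratio test.\<close>

lemma conv_radius_polynomial_growth:
  fixes g :: "nat \<Rightarrow> real"
  assumes "\<And>n. \<bar>g n\<bar> \<le> B * real (n + 1) ^ e"
  shows "conv_radius g \<ge> 1"
proof (rule conv_radius_geI_ex')
  fix r :: real assume r: "0 < r" "ereal r < 1"
  have "(\<lambda>n. (real (Suc n) / real (Suc (Suc n))) ^ e) \<longlonglongrightarrow> 1 ^ e"
    by (intro tendsto_power LIMSEQ_Suc[OF LIMSEQ_n_over_Suc_n])
  then have "conv_radius (\<lambda>n. real (n + 1) ^ e) = ereal 1"
    by (intro conv_radius_ratio_limit_nonzero) (auto simp: power_divide)
  then have "summable (\<lambda>n. norm (real (n + 1) ^ e * r ^ n))"
    using r by (intro abs_summable_in_conv_radius) (auto simp: one_ereal_def)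
  then have "summable (\<lambda>n. B * (real (n + 1) ^ e * r ^ n))"
    using r by (intro summable_mult) auto
  moreover have "norm (g n * r ^ n) \<le> B * (real (n + 1) ^ e * r ^ n)" for n
    using mult_right_mono[OF assms[of n], of "r ^ n"] r by (simp add: abs_mult mult_ac)
  ultimately have "summable (\<lambda>n. g n * r ^ n)"
    by (rule summable_comparison_test'[where N = 0])
  then show "summable (\<lambda>n. g n * of_real r ^ n)" by simp
qed

text \<open>Grouping the terms into blocks of length \<open>k\<close> sorts exponents by residue
  modulo \<open>k\<close>, which turns the recursion for the sections into a Mahler functional
  equation.\<close>

lemma power_series_section:
  fixes g :: "nat \<Rightarrow> real"
  assumes "k > 0" "summable (\<lambda>n. g n * x ^ n)"
    and rec: "\<And>n r. r < k \<Longrightarrow> g (k * n + r) = (\<Sum>h\<in>I. a r h * h n)"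
    and summ: "\<And>h. h \<in> I \<Longrightarrow> summable (\<lambda>n. h n * (x ^ k) ^ n)"
  shows "(\<Sum>n. g n * x ^ n) = (\<Sum>h\<in>I. (\<Sum>r<k. a r h * x ^ r) * (\<Sum>n. h n * (x ^ k) ^ n))"
proof -
  have "(\<lambda>n. \<Sum>i\<in>{n * k..<n * k + k}. g i * x ^ i) sums (\<Sum>n. g n * x ^ n)"
    using sums_group[OF summable_sums[OF assms(2)] assms(1)] .
  moreover have "(\<Sum>i\<in>{n * k..<n * k + k}. g i * x ^ i)
      = (\<Sum>h\<in>I. (\<Sum>r<k. a r h * x ^ r) * (h n * (x ^ k) ^ n))" for n
  proof -
    have "(\<Sum>i\<in>{n * k..<n * k + k}. g i * x ^ i) = (\<Sum>r<k. g (r + n * k) * x ^ (r + n * k))"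
      using sum.shift_bounds_nat_ivl[of "\<lambda>i. g i * x ^ i" 0 "n * k" k]
      by (simp add: add.commute atLeast0LessThan)
    also have "\<dots> = (\<Sum>r<k. \<Sum>h\<in>I. (a r h * x ^ r) * (h n * (x ^ k) ^ n))"
    proof (intro sum.cong refl)
      fix r assume "r \<in> {..<k}"
      then have "g (r + n * k) = (\<Sum>h\<in>I. a r h * h n)" using rec[of r n] by (simp add: ac_simps)
      moreover have "x ^ (r + n * k) = x ^ r * (x ^ k) ^ n"
        by (simp add: power_add power_mult[symmetric] mult.commute)
      ultimately show "g (r + n * k) * x ^ (r + n * k)
          = (\<Sum>h\<in>I. (a r h * x ^ r) * (h n * (x ^ k) ^ n))"
        by (simp add: sum_distrib_left sum_distrib_right mult_ac)
    qed
    also have "\<dots> = (\<Sum>h\<in>I. (\<Sum>r<k. a r h * x ^ r) * (h n * (x ^ k) ^ n))"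
      by (subst sum.swap) (simp add: sum_distrib_right)
    finally show ?thesis .
  qed
  moreover have "(\<lambda>n. \<Sum>h\<in>I. (\<Sum>r<k. a r h * x ^ r) * (h n * (x ^ k) ^ n))
      sums (\<Sum>h\<in>I. (\<Sum>r<k. a r h * x ^ r) * (\<Sum>n. h n * (x ^ k) ^ n))"
    by (intro sums_sum sums_mult summable_sums summ)
  ultimately show ?thesis by (simp add: sums_unique2)
qed

lemma sum_apply: "(\<Sum>i\<in>I. F i) x = (\<Sum>i\<in>I. F i x)" for F :: "'i \<Rightarrow> 'a \<Rightarrow> 'b::comm_monoid_add"
  by (induction I rule: infinite_finite_induct) auto

text \<open>The Cartier (decimation) operator; the \<open>k\<close>-kernel consists of all iterated
  images of a sequence under these operators with \<open>r < k\<close>.\<close>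

definition section_at :: "nat \<Rightarrow> nat \<Rightarrow> (nat \<Rightarrow> 'a) \<Rightarrow> nat \<Rightarrow> 'a" where
  "section_at k r g = (\<lambda>n. g (k * n + r))"

text \<open>Sections are linear and map the kernel into itself, hence preserve its span. Adjoining
  \<open>f\<close> and \<open>\<delta>\<close> keeps the closure, since the sections of
  \<open>\<delta>\<close> are \<open>\<delta>\<close> and 0; \<open>\<delta>\<close> supplies the
  constant series 1.\<close>

lemma regular_closed_basis:
  assumes k: "k \<ge> 2" and reg: "regular k f"
  defines "\<delta> \<equiv> \<lambda>n. if n = 0 then 1 else 0 :: rat"
  shows "\<exists>S. finite S \<and> (\<lambda>n. rat_of_int (f n)) \<in> S \<and> \<delta> \<in> S \<and>
    (\<forall>g\<in>S. \<forall>r<k. section_at k r g \<in> rat_seq.span S)"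
proof -
  define \<iota> where "\<iota> = (\<lambda>(g :: nat \<Rightarrow> int) n. rat_of_int (g n))"
  obtain B where B: "finite B" "rat_seq.span (\<iota> ` kernel k f) = rat_seq.span B"
    using reg unfolding regular_def \<iota>_def by blast
  have "f \<in> kernel k f"
    unfolding kernel_def by (rule CollectI, rule exI[of _ 0], rule exI[of _ 0]) simp
  have shift: "section_at k r g \<in> \<iota> ` kernel k f" if gr: "g \<in> \<iota> ` kernel k f" "r < k" for g r
  proof -
    obtain l j where g: "g = \<iota> (\<lambda>n. f (k ^ l * n + j))" "j < k ^ l"
      using gr(1) unfolding kernel_def by blast
    \<comment> \<open>The section \<open>r\<close> of the kernel element with parameters
      \<open>l\<close>, \<open>j\<close> has parameters \<open>Suc l\<close>,
      \<open>j + k ^ l * r\<close>.\<close>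
    have "j + k ^ l * r < k ^ l + k ^ l * r" using g(2) by simp
    also have "\<dots> = k ^ l * Suc r" by simp
    also have "\<dots> \<le> k ^ l * k" using gr(2) by (intro mult_le_mono2) simp
    finally have "j + k ^ l * r < k ^ Suc l" by (simp add: mult.commute)
    moreover have "section_at k r g = \<iota> (\<lambda>n. f (k ^ Suc l * n + (j + k ^ l * r)))"
      by (simp add: g section_at_def \<iota>_def algebra_simps)
    ultimately show ?thesis unfolding kernel_def by blast
  qed
  have lin: "module_hom seq_scale seq_scale (section_at k r)" for r
    by unfold_locales (auto simp: section_at_def seq_scale_def fun_eq_iff algebra_simps)
  have span_shift: "section_at k r g \<in> rat_seq.span (\<iota> ` kernel k f)"
    if "g \<in> rat_seq.span (\<iota> ` kernel k f)" "r < k" for g r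
  proof -
    have "section_at k r g \<in> rat_seq.span (section_at k r ` \<iota> ` kernel k f)"
      using module_hom.span_image[OF lin[of r]] that(1) by blast
    also have "\<dots> \<subseteq> rat_seq.span (\<iota> ` kernel k f)"
      using shift that(2) by (intro rat_seq.span_mono) blast
    finally show ?thesis .
  qed
  define S where "S = insert (\<iota> f) (insert \<delta> B)"
  have sub: "rat_seq.span (\<iota> ` kernel k f) \<subseteq> rat_seq.span S"
    unfolding B(2) by (rule rat_seq.span_mono) (auto simp: S_def)
  have "section_at k r g \<in> rat_seq.span S" if "g \<in> S" "r < k" for g r
  proof -
    consider "g = \<delta>" | "g \<in> rat_seq.span (\<iota> ` kernel k f)"
      using \<open>g \<in> S\<close> \<open>f \<in> kernel k f\<close> B(2) unfolding S_def by (auto intro: rat_seq.span_base)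
    then show ?thesis
    proof cases
      case 1
      have "section_at k r \<delta> = (if r = 0 then \<delta> else 0)"
        using k by (auto simp: section_at_def \<delta>_def fun_eq_iff)
      then show ?thesis using 1 by (auto simp: S_def intro: rat_seq.span_base rat_seq.span_zero)
    next
      case 2
      then show ?thesis using span_shift[OF 2 that(2)] sub by blast
    qed
  qed
  then show ?thesis using B(1) by (intro exI[of _ S]) (auto simp: S_def \<iota>_def)
qed

text \<open>The system is indexed by the sequences themselves, so \<open>Abs_fps\<close> is the
  family of series; polynomial growth of the sequences gives radius of convergence at least
  1.\<close>

lemma regular_mahler_system:
  assumes k: "k \<ge> 2" and b: "b \<ge> 2" and reg: "regular k f"
  shows "\<exists>(I :: (nat \<Rightarrow> real) set) A. mahler_system k b I Abs_fps A \<and>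
    (\<lambda>n. real_of_int (f n)) \<in> I \<and> (\<lambda>n. if n = 0 then 1 else 0) \<in> I"
proof -
  let ?\<delta> = "\<lambda>n::nat. if n = 0 then 1 else 0 :: rat"
  obtain S where S: "finite S" "(\<lambda>n. rat_of_int (f n)) \<in> S" "?\<delta> \<in> S"
      "\<And>g r. g \<in> S \<Longrightarrow> r < k \<Longrightarrow> section_at k r g \<in> rat_seq.span S"
    using regular_closed_basis[OF k reg] by blast
  define \<rho> where "\<rho> = (\<lambda>(g :: nat \<Rightarrow> rat) n. real_of_rat (g n))"
  have inj: "inj \<rho>" unfolding \<rho>_def inj_def by (auto simp: fun_eq_iff)
  have "\<exists>a. \<forall>n. g (k * n + r) = (\<Sum>h\<in>S. a h * h n)" if gr: "g \<in> S" "r < k" for g r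
  proof -
    obtain a where "section_at k r g = (\<Sum>h\<in>S. seq_scale (a h) h)"
      using S(4)[OF gr] unfolding rat_seq.span_finite[OF S(1)] by blast
    then have "g (k * n + r) = (\<Sum>h\<in>S. seq_scale (a h) h) n" for n
      unfolding section_at_def by metis
    then have "g (k * n + r) = (\<Sum>h\<in>S. a h * h n)" for n
      by (simp add: sum_apply seq_scale_def)
    then show ?thesis by blast
  qed
  then obtain a where a: "\<And>g r n. g \<in> S \<Longrightarrow> r < k \<Longrightarrow> g (k * n + r) = (\<Sum>h\<in>S. a g r h * h n)"
    by metis
  define I where "I = \<rho> ` S"
  \<comment> \<open>The injection \<open>\<rho>\<close> embeds rational sequences into real ones;
    its inverse carries the recursion coefficients to the new index set.\<close>
  define \<alpha> where "\<alpha> = (\<lambda>g r h. real_of_rat (a (inv \<rho> g) r (inv \<rho> h)))"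
  have rec: "g (k * n + r) = (\<Sum>h\<in>I. \<alpha> g r h * h n)" if gr: "g \<in> I" "r < k" for g n r
  proof -
    obtain g' where g': "g' \<in> S" "g = \<rho> g'" using gr(1) by (auto simp: I_def)
    have "(\<Sum>h\<in>I. \<alpha> g r h * h n) = (\<Sum>h\<in>S. \<alpha> g r (\<rho> h) * \<rho> h n)"
      unfolding I_def using inj by (subst sum.reindex) (auto intro: inj_on_subset)
    also have "\<dots> = real_of_rat (\<Sum>h\<in>S. a g' r h * h n)"
      using inj by (simp add: \<alpha>_def g'(2) \<rho>_def[symmetric] inv_f_f of_rat_sum of_rat_mult)
         (simp add: \<rho>_def)
    finally show ?thesis using a[OF g'(1) gr(2)] by (simp add: g'(2) \<rho>_def)
  qed
  have finI: "finite I" using S(1) by (simp add: I_def)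
  obtain B e where growth: "\<And>g n. g \<in> I \<Longrightarrow> \<bar>g n\<bar> \<le> B * real (n + 1) ^ e"
    using linear_recursion_polynomial_growth[OF k finI rec] by blast
  have radius: "fps_conv_radius (Abs_fps g) \<ge> 1" if "g \<in> I" for g
    using conv_radius_polynomial_growth[OF growth[OF that]] by (simp add: fps_conv_radius_def)
  have summ: "summable (\<lambda>n. g n * x ^ n)" if "g \<in> I" "\<bar>x\<bar> < 1" for g x
    using summable_fps[of x "Abs_fps g"] less_le_trans[OF _ radius[OF that(1)], of "ereal \<bar>x\<bar>"] that(2)
    by (simp add: one_ereal_def)
  define A where "A = (\<lambda>g h. \<Sum>r<k. monom (\<alpha> g r h) r)"
  have "mahler_system k b I Abs_fps A"
  proof
    show "fps_nth (Abs_fps g) n \<in> \<rat>" if "g \<in> I" for g n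
      using that by (auto simp: I_def \<rho>_def)
    show "coeff (A g h) n \<in> \<rat>" for g h n
      by (auto simp: A_def coeff_sum coeff_monom \<alpha>_def)
    show "eval_fps (Abs_fps g) x = (\<Sum>h\<in>I. poly (A g h) x * eval_fps (Abs_fps h) (x ^ k))"
      if g: "g \<in> I" and x: "\<bar>x\<bar> < 1" for g x
    proof -
      have "\<bar>x ^ k\<bar> < 1" using x k by (simp add: power_abs power_less_one_iff)
      then have "(\<Sum>n. g n * x ^ n) = (\<Sum>h\<in>I. (\<Sum>r<k. \<alpha> g r h * x ^ r) * (\<Sum>n. h n * (x ^ k) ^ n))"
        by (intro power_series_section) (use k g x rec summ in auto)
      then show ?thesis by (simp add: eval_fps_def A_def poly_sum poly_monom)
    qed
  qed (use k b finI radius in auto)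
  moreover have "(\<lambda>n. real_of_int (f n)) \<in> I"
    using imageI[OF S(2), of \<rho>] by (simp add: I_def \<rho>_def)
  moreover have "\<rho> ?\<delta> = (\<lambda>n. if n = 0 then 1 else 0)"
    by (auto simp: \<rho>_def)
  then have "(\<lambda>n. if n = 0 then 1 else 0) \<in> I"
    using imageI[OF S(3), of \<rho>] by (simp add: I_def)
  ultimately show ?thesis by blast
qed

section \<open>Products of Mahler systems\<close>

lemma fps_prod_radius_eval:
  fixes G :: "'i \<Rightarrow> real fps"
  assumes "\<And>i. i \<in> S \<Longrightarrow> fps_conv_radius (G i) \<ge> 1"
  shows "fps_conv_radius (\<Prod>i\<in>S. G i) \<ge> 1"
    and "\<bar>x\<bar> < 1 \<Longrightarrow> eval_fps (\<Prod>i\<in>S. G i) x = (\<Prod>i\<in>S. eval_fps (G i) x)"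
proof -
  have "fps_conv_radius (\<Prod>i\<in>S. G i) \<ge> 1 \<and>
      (\<bar>x\<bar> < 1 \<longrightarrow> eval_fps (\<Prod>i\<in>S. G i) x = (\<Prod>i\<in>S. eval_fps (G i) x))"
    using assms
  proof (induction S rule: infinite_finite_induct)
    case (insert i S)
    have r: "fps_conv_radius (G i) \<ge> 1" "fps_conv_radius (\<Prod>i\<in>S. G i) \<ge> 1"
      using insert by auto
    have "fps_conv_radius (G i * (\<Prod>i\<in>S. G i)) \<ge> 1"
      using fps_conv_radius_mult[of "G i" "\<Prod>i\<in>S. G i"] r by (meson min.boundedI order_trans)
    moreover have "eval_fps (G i * (\<Prod>i\<in>S. G i)) x = eval_fps (G i) x * eval_fps (\<Prod>i\<in>S. G i) x"
      if "\<bar>x\<bar> < 1"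
      using that less_le_trans[OF _ r(1), of "ereal \<bar>x\<bar>"] less_le_trans[OF _ r(2), of "ereal \<bar>x\<bar>"]
      by (intro eval_fps_mult) (auto simp: one_ereal_def)
    ultimately show ?case using insert by simp
  qed auto
  then show "fps_conv_radius (\<Prod>i\<in>S. G i) \<ge> 1"
    and "\<bar>x\<bar> < 1 \<Longrightarrow> eval_fps (\<Prod>i\<in>S. G i) x = (\<Prod>i\<in>S. eval_fps (G i) x)"
    by auto
qed

lemma fps_prod_nth_Rats:
  fixes G :: "'i \<Rightarrow> real fps"
  assumes "\<And>i n. i \<in> S \<Longrightarrow> fps_nth (G i) n \<in> \<rat>"
  shows "fps_nth (\<Prod>i\<in>S. G i) n \<in> \<rat>"
  using assms
proof (induction S arbitrary: n rule: infinite_finite_induct)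
  case (insert i S)
  then show ?case
    by (auto simp: fps_mult_nth intro!: ring_closed_sum[OF ring_closed_Rats] Rats_mult)
qed auto

lemma poly_prod_coeff_Rats:
  fixes p :: "'i \<Rightarrow> real poly"
  assumes "\<And>i n. i \<in> S \<Longrightarrow> coeff (p i) n \<in> \<rat>"
  shows "coeff (\<Prod>i\<in>S. p i) n \<in> \<rat>"
  using assms
proof (induction S arbitrary: n rule: infinite_finite_induct)
  case (insert i S)
  then show ?case
    by (auto simp: coeff_mult intro!: ring_closed_sum[OF ring_closed_Rats] Rats_mult)
qed auto

text \<open>Multiplying \<open>m\<close> functional equations and expanding the product of sums
  yields one term per map from \<open>{..<m}\<close> to \<open>I\<close>; the new matrix is the
  \<open>m\<close>-fold Kronecker power of \<open>A\<close>.\<close>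

lemma (in mahler_system) product_system:
  "mahler_system k b ({..<m::nat} \<rightarrow>\<^sub>E I) (\<lambda>\<phi>. \<Prod>t<m. H (\<phi> t)) (\<lambda>\<phi> \<psi>. \<Prod>t<m. A (\<phi> t) (\<psi> t))"
proof
  show "finite ({..<m} \<rightarrow>\<^sub>E I)" using fin by (intro finite_PiE) auto
  show "fps_nth (\<Prod>t<m. H (\<phi> t)) n \<in> \<rat>" if "\<phi> \<in> {..<m} \<rightarrow>\<^sub>E I" for \<phi> n
    using that H_rat by (intro fps_prod_nth_Rats) auto
  show "fps_conv_radius (\<Prod>t<m. H (\<phi> t)) \<ge> 1" if "\<phi> \<in> {..<m} \<rightarrow>\<^sub>E I" for \<phi>
    using that H_radius by (intro fps_prod_radius_eval) auto
  show "coeff (\<Prod>t<m. A (\<phi> t) (\<psi> t)) n \<in> \<rat>"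
    if "\<phi> \<in> {..<m} \<rightarrow>\<^sub>E I" "\<psi> \<in> {..<m} \<rightarrow>\<^sub>E I" for \<phi> \<psi> n
    using that by (intro poly_prod_coeff_Rats A_rat) (auto simp: PiE_iff)
  show "eval_fps (\<Prod>t<m. H (\<phi> t)) x = (\<Sum>\<psi>\<in>{..<m} \<rightarrow>\<^sub>E I.
      poly (\<Prod>t<m. A (\<phi> t) (\<psi> t)) x * eval_fps (\<Prod>t<m. H (\<psi> t)) (x ^ k))"
    if \<phi>: "\<phi> \<in> {..<m} \<rightarrow>\<^sub>E I" and x: "\<bar>x\<bar> < 1" for \<phi> x
  proof -
    have xk: "\<bar>x ^ k\<bar> < 1" using x k by (simp add: power_abs power_less_one_iff)
    have "eval_fps (\<Prod>t<m. H (\<phi> t)) x = (\<Prod>t<m. eval_fps (H (\<phi> t)) x)"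
      using \<phi> H_radius x by (intro fps_prod_radius_eval) auto
    also have "\<dots> = (\<Prod>t<m. \<Sum>j\<in>I. poly (A (\<phi> t) j) x * eval_fps (H j) (x ^ k))"
      using \<phi> x by (intro prod.cong refl functional_eq) auto
    also have "\<dots> = (\<Sum>\<psi>\<in>{..<m} \<rightarrow>\<^sub>E I. \<Prod>t<m. poly (A (\<phi> t) (\<psi> t)) x * eval_fps (H (\<psi> t)) (x ^ k))"
      using fin by (intro prod_sum_PiE) auto
    also have "\<dots> = (\<Sum>\<psi>\<in>{..<m} \<rightarrow>\<^sub>E I.
        poly (\<Prod>t<m. A (\<phi> t) (\<psi> t)) x * eval_fps (\<Prod>t<m. H (\<psi> t)) (x ^ k))"
    proof (intro sum.cong refl)
      fix \<psi> assume "\<psi> \<in> {..<m} \<rightarrow>\<^sub>E I"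
      then have "eval_fps (\<Prod>t<m. H (\<psi> t)) (x ^ k) = (\<Prod>t<m. eval_fps (H (\<psi> t)) (x ^ k))"
        using H_radius xk by (intro fps_prod_radius_eval) auto
      then show "(\<Prod>t<m. poly (A (\<phi> t) (\<psi> t)) x * eval_fps (H (\<psi> t)) (x ^ k)) =
          poly (\<Prod>t<m. A (\<phi> t) (\<psi> t)) x * eval_fps (\<Prod>t<m. H (\<psi> t)) (x ^ k)"
        by (simp add: prod.distrib poly_prod)
    qed
    finally show ?thesis .
  qed
qed (use k b in auto)

section \<open>Mahler's exponents\<close>

lemma coeff_le_height: "\<bar>coeff P i\<bar> \<le> height P"
proof (cases "i \<le> degree P")
  case True
  then show ?thesis unfolding height_def by (intro Max_ge) auto
next
  case False
  then have "\<bar>coeff P i\<bar> \<le> \<bar>coeff P 0\<bar>" by (simp add: coeff_eq_0)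
  also have "\<dots> \<le> height P" unfolding height_def by (intro Max_ge) auto
  finally show ?thesis .
qed

lemma height_ge_1: "P \<noteq> 0 \<Longrightarrow> height P \<ge> 1"
  using coeff_le_height[of P "degree P"] leading_coeff_neq_0[of P] by linarith

lemma finite_bounded_height: "finite {P. degree P \<le> m \<and> height P \<le> K}"
proof (rule finite_subset)
  let ?L = "{xs. set xs \<subseteq> {-K..K} \<and> length xs = Suc m}"
  show "{P. degree P \<le> m \<and> height P \<le> K} \<subseteq> Poly ` ?L"
  proof
    fix P assume "P \<in> {P. degree P \<le> m \<and> height P \<le> K}"
    then have P: "degree P \<le> m" "\<And>i. \<bar>coeff P i\<bar> \<le> K"
      using coeff_le_height[of P] by (auto intro: order_trans)
    have "P = Poly (map (coeff P) [0..<Suc m])"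
      using P(1) by (intro poly_eqI) (auto simp: nth_default_def coeff_eq_0 simp del: upt_Suc)
    moreover have "map (coeff P) [0..<Suc m] \<in> ?L"
      using P(2) by (auto simp: abs_le_iff minus_le_iff simp del: upt_Suc)
    ultimately show "P \<in> Poly ` ?L" by blast
  qed
  show "finite (Poly ` ?L)" by (intro finite_imageI finite_lists_length_eq) simp
qed

text \<open>An exponent \<open>w > W + 1\<close> would give \<open>C \<le> 1 / h\<close> for the
  height \<open>h\<close>, leaving only finitely many polynomials. Hence the supremum is at most
  \<open>W + 1\<close>.\<close>

lemma mahler_w_finiteI:
  assumes C: "C > 0"
    and bound: "\<And>P. degree P \<le> m \<Longrightarrow> poly (map_poly real_of_int P) \<xi> \<noteq> 0 \<Longrightarrow>
      C \<le> \<bar>poly (map_poly real_of_int P) \<xi>\<bar> * real_of_int (height P) ^ W"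
  shows "mahler_w m \<xi> < \<infinity>"
proof -
  let ?v = "\<lambda>P. \<bar>poly (map_poly real_of_int P) \<xi>\<bar>"
  have "w \<le> real (W + 1)"
    if inf: "infinite {P. degree P \<le> m \<and> 0 < ?v P \<and> ?v P < real_of_int (height P) powr (- w)}" for w
  proof (rule ccontr)
    assume w: "\<not> w \<le> real (W + 1)"
    have "{P. degree P \<le> m \<and> 0 < ?v P \<and> ?v P < real_of_int (height P) powr (- w)}
        \<subseteq> {P. degree P \<le> m \<and> height P \<le> \<lceil>1 / C\<rceil>}"
    proof safe
      fix P assume P: "degree P \<le> m" "0 < ?v P" "?v P < real_of_int (height P) powr (- w)"
      define h where "h = real_of_int (height P)"
      have "P \<noteq> 0" using P(2) by auto
      then have h: "h \<ge> 1" using height_ge_1[of P] by (simp add: h_def)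
      have "C \<le> ?v P * h ^ W" using bound[OF P(1)] P(2) by (simp add: h_def)
      also have "\<dots> \<le> h powr (- w) * h ^ W"
        using P(3) h by (intro mult_right_mono) (auto simp: h_def)
      also have "\<dots> = h powr (real W - w)"
        using h by (simp add: powr_realpow[symmetric] powr_add[symmetric])
      also have "\<dots> \<le> h powr (- 1)" using w h by (intro powr_mono) auto
      also have "\<dots> = 1 / h" using h by (simp add: powr_minus_divide)
      finally have "h \<le> 1 / C" using C h by (simp add: field_simps)
      then show "height P \<le> \<lceil>1 / C\<rceil>" unfolding h_def by linarith
    qed
    then show False using inf finite_bounded_height finite_subset by blast
  qed
  then have "mahler_w m \<xi> \<le> ereal (real (W + 1))"
    unfolding mahler_w_def by (intro Sup_least) auto
  then show ?thesis by (rule le_less_trans) simp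
qed

lemma mahler_w_finite_if_regular:
  assumes k: "k \<ge> 2" and b: "b \<ge> 2" and reg: "regular k f"
  shows "mahler_w m (eval_fps (Abs_fps (\<lambda>n. real_of_int (f n))) (1 / real b)) < \<infinity>"
proof -
  define \<xi> where "\<xi> = eval_fps (Abs_fps (\<lambda>n. real_of_int (f n))) (1 / real b)"
  define \<phi> :: "nat \<Rightarrow> real" where "\<phi> = (\<lambda>n. real_of_int (f n))"
  define \<delta> :: "nat \<Rightarrow> real" where "\<delta> = (\<lambda>n. if n = 0 then 1 else 0)"
  obtain I A where sys: "mahler_system k b I Abs_fps A" and I: "\<phi> \<in> I" "\<delta> \<in> I"
    using regular_mahler_system[OF k b reg] unfolding \<phi>_def \<delta>_def by blast
  interpret base: mahler_system k b I Abs_fps A by (rule sys)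
  let ?J = "{..<m} \<rightarrow>\<^sub>E I"
  let ?H = "\<lambda>\<psi>. \<Prod>t<m. Abs_fps (\<psi> t)"
  interpret prod: mahler_system k b ?J ?H "\<lambda>\<psi> \<psi>'. \<Prod>t<m. A (\<psi> t) (\<psi>' t)"
    by (rule base.product_system)
  have x: "\<bar>1 / real b\<bar> < 1" using b by simp
  \<comment> \<open>The monomial with \<open>\<phi>\<close> in the first \<open>t\<close> places and
    \<open>\<delta>\<close> in the others; its value at \<open>1 / b\<close> is
    \<open>\<xi> ^ t\<close>.\<close>
  define \<mu> where "\<mu> = (\<lambda>t. \<lambda>s\<in>{..<m}. if s < t then \<phi> else \<delta>)"
  have \<mu>: "\<mu> t \<in> ?J" for t using I by (auto simp: \<mu>_def)
  have "Abs_fps \<delta> = 1" by (auto simp: \<delta>_def fps_eq_iff)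
  then have vals: "eval_fps (Abs_fps \<delta>) (1 / real b) = 1" "eval_fps (Abs_fps \<phi>) (1 / real b) = \<xi>"
    by (simp_all add: \<xi>_def \<phi>_def)
  have power: "eval_fps (?H (\<mu> t)) (1 / real b) = \<xi> ^ t" if "t \<le> m" for t
  proof -
    have "eval_fps (?H (\<mu> t)) (1 / real b) = (\<Prod>s<m. eval_fps (Abs_fps (\<mu> t s)) (1 / real b))"
      using x \<mu>[of t] base.H_radius by (intro fps_prod_radius_eval) auto
    also have "\<dots> = (\<Prod>s<m. if s < t then \<xi> else 1)"
      by (intro prod.cong) (auto simp: \<mu>_def vals)
    also have "\<dots> = (\<Prod>s\<in>{..<m} \<inter> {..<t}. \<xi>)"
      by (subst prod.inter_restrict) auto
    also have "{..<m} \<inter> {..<t} = {..<t}" using that by auto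
    finally show ?thesis by simp
  qed
  obtain C W where C: "C > 0" and measure: "\<And>c h. (\<forall>\<psi>\<in>?J. c \<psi> \<in> \<int> \<and> \<bar>c \<psi>\<bar> \<le> h) \<Longrightarrow> h \<ge> 1 \<Longrightarrow>
      prod.form c \<noteq> 0 \<Longrightarrow> C \<le> \<bar>prod.form c\<bar> * h ^ W"
    using prod.linear_form_measure by blast
  have "C / real (m + 1) ^ W \<le> \<bar>poly (map_poly real_of_int P) \<xi>\<bar> * real_of_int (height P) ^ W"
    if P: "degree P \<le> m" "poly (map_poly real_of_int P) \<xi> \<noteq> 0" for P
  proof -
    \<comment> \<open>The indices \<open>\<mu> t\<close> coincide when
      \<open>\<phi> = \<delta>\<close>, so coefficients are added up; this accounts for the factor
      \<open>m + 1\<close> in \<open>h\<close>.\<close>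
    define c where "c = (\<lambda>\<psi>. \<Sum>t\<le>m. if \<psi> = \<mu> t then real_of_int (coeff P t) else 0)"
    define h where "h = real (m + 1) * real_of_int (height P)"
    have "P \<noteq> 0" using P(2) by auto
    then have hP: "real_of_int (height P) \<ge> 1" using height_ge_1[of P] by simp
    then have h: "h \<ge> 1" unfolding h_def by (intro mult_ge1_I) auto
    have "c \<psi> \<in> \<int>" for \<psi> unfolding c_def by (intro Ints_sum) auto
    moreover have "\<bar>c \<psi>\<bar> \<le> h" for \<psi>
    proof -
      have "\<bar>c \<psi>\<bar> \<le> (\<Sum>t\<le>m. \<bar>if \<psi> = \<mu> t then real_of_int (coeff P t) else 0\<bar>)"
        unfolding c_def by (rule sum_abs)
      also have "\<dots> \<le> (\<Sum>t\<le>m. real_of_int (height P))"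
        using coeff_le_height[of P] hP by (intro sum_mono) (auto simp flip: of_int_abs)
      finally show ?thesis by (simp add: h_def)
    qed
    moreover have form: "prod.form c = poly (map_poly real_of_int P) \<xi>"
    proof -
      have "prod.form c = (\<Sum>\<psi>\<in>?J. \<Sum>t\<le>m. if \<psi> = \<mu> t then real_of_int (coeff P t) *
          eval_fps (?H \<psi>) (1 / real b) else 0)"
        unfolding prod.form_def c_def sum_distrib_right by (intro sum.cong refl) simp
      also have "\<dots> = (\<Sum>t\<le>m. \<Sum>\<psi>\<in>?J. if \<psi> = \<mu> t then real_of_int (coeff P t) *
          eval_fps (?H \<psi>) (1 / real b) else 0)"
        by (rule sum.swap)
      also have "\<dots> = (\<Sum>t\<le>m. real_of_int (coeff P t) * eval_fps (?H (\<mu> t)) (1 / real b))"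
        using \<mu> by (intro sum.cong refl) (simp only: sum.delta[OF prod.fin] if_True)
      also have "\<dots> = (\<Sum>t\<le>m. real_of_int (coeff P t) * \<xi> ^ t)"
        by (intro sum.cong refl) (simp add: power)
      also have "\<dots> = poly (map_poly real_of_int P) \<xi>"
        unfolding poly_altdef using P(1)
        by (intro sum.mono_neutral_cong_right) (auto simp: coeff_map_poly coeff_eq_0 degree_map_poly)
      finally show ?thesis .
    qed
    ultimately have "C \<le> \<bar>poly (map_poly real_of_int P) \<xi>\<bar> * h ^ W"
      using measure[of c h] h P(2) by simp
    then have "C \<le> (\<bar>poly (map_poly real_of_int P) \<xi>\<bar> * real_of_int (height P) ^ W) * real (m + 1) ^ W"
      unfolding h_def power_mult_distrib by (simp only: mult_ac)
    then show ?thesis by (subst pos_divide_le_eq) auto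
  qed
  then show ?thesis
    unfolding \<xi>_def[symmetric] using C by (intro mahler_w_finiteI[of "C / real (m + 1) ^ W"]) auto
qed

text \<open>All exponents \<open>mahler_w m \<xi>\<close> are finite, so the value of
  \<open>mahler_w_lim \<xi>\<close> alone decides between the two classes.\<close>

theorem theorem1p3:
  fixes k b :: nat and f :: "nat \<Rightarrow> int" and F :: "int fps" and \<xi> :: real
  assumes "k \<ge> 2"
    and "regular k f"
    and "F = Abs_fps f"
    and "b \<ge> 2"
    and "\<xi> = eval_fps (Abs_fps (\<lambda>n. real_of_int (fps_nth F n))) (1 / real b)"
    and "\<xi> \<notin> \<rat>"
  shows "S_number \<xi> \<or> T_number \<xi>"
proof -
  have "mahler_w m \<xi> < \<infinity>" for m
    using mahler_w_finite_if_regular[OF assms(1,4,2), of m] assms(3,5) by simp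
  then show ?thesis
    using assms(6) unfolding S_number_def T_number_def by auto
qed

end
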